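(* Assume that there is no $Q$-point. Then for every Tychonov space $X$ the following conditions are equivalent: (1) all finite powers of the free topological group $F(X)$ are $o$-bounded; (2) the free topological group $F(X)$ is $o$-bounded; (3) the free abelian topological group $A(X)$ is $o$-bounded; (4) every continuous metrizable image of $X$ is Scheepers.
   Context: A $Q$-point is a free ultrafilter $\mathcal U$ on $\omega$ such that each finite-to-one function $f:\omega\to\omega$ is injective on some set $U\in\mathcal U$; here $f$ is finite-to-one if $f^{-1}(y)$ is finite and nonempty for each $y\in\omega$. A topological group $G$ with neutral element $e$ is $o$-bounded if for every sequence $\langle U_n\rangle_{n\in\omega}$ of neighborhoods of $e$ there is a sequence $\langle F_n\rangle_{n\in\omega}$ of finite subsets of $G$ such that $G=\bigcup_{n\in\omega}U_n\cdot F_n$. The free abelian topological group over a Tychonov space $X$ is an abelian topological group $A(X)$ that contains $X$ as a subspace and such that each continuous map $\phi:X\to G$ into an abelian topological group $G$ extends to a unique continuous group homomorphism $\Phi:A(X)\to G$. Deleting the adjective "abelian" everywhere gives the definition of the free topological group $F(X)$ over $X$. A cover $\mathcal U$ of a set $X$ is an $\omega$-cover if each finite subset of $X$ lies in some element of $\mathcal U$. A topological space $X$ is Scheepers if for every sequence $\langle \mathcal U_n\rangle_{n\in\omega}$ of open covers of $X$ there are finite subfamilies $\mathcal V_n\subset\mathcal U_n$, $n\in\omega$, such that $\langle\bigcup\mathcal V_n\rangle_{n\in\omega}$ is an $\omega$-cover of $X$. A continuous metrizable image of $X$ is a metrizable space $T$ for which there is a continuous surjection $X\to T$. *)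

theory Defs
  imports "HOL-Analysis.Analysis" "HOL-Algebra.Product_Groups"
begin

section \<open>Q-points\<close>

definition ultrafilter :: "'a filter \<Rightarrow> bool"
  where "ultrafilter U \<longleftrightarrow> U \<noteq> bot \<and> (\<forall>P. eventually P U \<or> eventually (\<lambda>x. \<not> P x) U)"

definition free_ultrafilter :: "'a filter \<Rightarrow> bool"
  where "free_ultrafilter U \<longleftrightarrow> ultrafilter U \<and> (\<forall>a. eventually (\<lambda>x. x \<noteq> a) U)"

text \<open>Fibres are required to be nonempty as well as finite, so these maps are surjective.\<close>

definition finite_to_one :: "('a \<Rightarrow> 'b) \<Rightarrow> bool"
  where "finite_to_one f \<longleftrightarrow> (\<forall>y. finite (f -` {y}) \<and> f -` {y} \<noteq> {})"

definition Q_point :: "nat filter \<Rightarrow> bool"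
  where "Q_point U \<longleftrightarrow> free_ultrafilter U \<and>
    (\<forall>f :: nat \<Rightarrow> nat. finite_to_one f \<longrightarrow> (\<exists>A. eventually (\<lambda>n. n \<in> A) U \<and> inj_on f A))"


section \<open>Topological groups\<close>

text \<open>No separation axiom is part of the definition.\<close>

locale topological_group = group G
  for G :: "('g, 'm) monoid_scheme" (structure) and T :: "'g topology" +
  assumes topspace_eq_carrier: "topspace T = carrier G"
    and continuous_mult: "continuous_map (prod_topology T T) T (\<lambda>(x, y). x \<otimes> y)"
    and continuous_inv: "continuous_map T T (\<lambda>x. inv x)"

definition neighborhood_of_one :: "('g, 'm) monoid_scheme \<Rightarrow> 'g topology \<Rightarrow> 'g set \<Rightarrow> bool"
  where "neighborhood_of_one G T U \<longleftrightarrow>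
    U \<subseteq> topspace T \<and> (\<exists>V. openin T V \<and> \<one>\<^bsub>G\<^esub> \<in> V \<and> V \<subseteq> U)"

definition o_bounded :: "('g, 'm) monoid_scheme \<Rightarrow> 'g topology \<Rightarrow> bool"
  where "o_bounded G T \<longleftrightarrow>
    (\<forall>U :: nat \<Rightarrow> 'g set. (\<forall>n. neighborhood_of_one G T (U n)) \<longrightarrow>
      (\<exists>F :: nat \<Rightarrow> 'g set. (\<forall>n. finite (F n) \<and> F n \<subseteq> carrier G) \<and>
        carrier G = (\<Union>n. U n <#>\<^bsub>G\<^esub> F n)))"

abbreviation power_group :: "nat \<Rightarrow> ('g, 'm) monoid_scheme \<Rightarrow> (nat \<Rightarrow> 'g) monoid"
  where "power_group n G \<equiv> product_group {..<n} (\<lambda>_. G)"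

abbreviation power_topology :: "nat \<Rightarrow> 'g topology \<Rightarrow> (nat \<Rightarrow> 'g) topology"
  where "power_topology n T \<equiv> product_topology (\<lambda>_. T) {..<n}"


section \<open>Free topological groups\<close>

text \<open>
  A map on a carrier is represented by its extensional representative, so that uniqueness is
  uniqueness on the carrier.
\<close>

definition extends_to_hom ::
  "'x topology \<Rightarrow> ('f, 'm) monoid_scheme \<Rightarrow> 'f topology \<Rightarrow> ('x \<Rightarrow> 'f) \<Rightarrow>
    ('h, 'n) monoid_scheme \<Rightarrow> 'h topology \<Rightarrow> ('x \<Rightarrow> 'h) \<Rightarrow> ('f \<Rightarrow> 'h) \<Rightarrow> bool"
  where "extends_to_hom X F T i H S \<phi> \<Phi> \<longleftrightarrow>
    \<Phi> \<in> extensional (carrier F) \<and> \<Phi> \<in> hom F H \<and> continuous_map T S \<Phi> \<and>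
    (\<forall>x\<in>topspace X. \<Phi> (i x) = \<phi> x)"

text \<open>
  \<open>free_topological_group X F T i\<close>: the group \<open>F\<close> with topology \<open>T\<close> is free over \<open>X\<close>, which sits
  in it via the embedding \<open>i\<close>.  A HOL definition cannot quantify over the carrier types of the
  target groups \<open>H\<close>.  It is enough to let \<open>H\<close> range over the groups carried by the type of words
  over two copies of the elements of \<open>F\<close>: every target, of any type, may be replaced by a subgroup
  that is an image of this type.  The lemmas \<open>free_topological_group_universal\<close> and
  \<open>free_abelian_topological_group_universal\<close> below derive the universal property for targets of
  arbitrary type.
\<close>

definition free_topological_group ::
  "'x topology \<Rightarrow> ('f, 'm) monoid_scheme \<Rightarrow> 'f topology \<Rightarrow> ('x \<Rightarrow> 'f) \<Rightarrow> bool"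
  where "free_topological_group X F T i \<longleftrightarrow>
    topological_group F T \<and> embedding_map X T i \<and>
    (\<forall>(H :: ('f \<times> bool) list monoid) S \<phi>.
      topological_group H S \<and> continuous_map X S \<phi> \<longrightarrow> (\<exists>!\<Phi>. extends_to_hom X F T i H S \<phi> \<Phi>))"

definition free_abelian_topological_group ::
  "'x topology \<Rightarrow> ('f, 'm) monoid_scheme \<Rightarrow> 'f topology \<Rightarrow> ('x \<Rightarrow> 'f) \<Rightarrow> bool"
  where "free_abelian_topological_group X F T i \<longleftrightarrow>
    topological_group F T \<and> comm_group F \<and> embedding_map X T i \<and>
    (\<forall>(H :: ('f \<times> bool) list monoid) S \<phi>.
      topological_group H S \<and> comm_group H \<and> continuous_map X S \<phi> \<longrightarrow>
        (\<exists>!\<Phi>. extends_to_hom X F T i H S \<phi> \<Phi>))"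

definition word_value :: "('h, 'm) monoid_scheme \<Rightarrow> ('a \<Rightarrow> 'h) \<Rightarrow> 'a list \<Rightarrow> 'h"
  where "word_value H s w = foldr (\<lambda>a y. s a \<otimes>\<^bsub>H\<^esub> y) w \<one>\<^bsub>H\<^esub>"

context group
begin

lemma word_value_closed: "range s \<subseteq> carrier G \<Longrightarrow> word_value G s w \<in> carrier G"
  by (induction w) (auto simp: word_value_def)

lemma word_value_append:
  "range s \<subseteq> carrier G \<Longrightarrow> word_value G s (u @ v) = word_value G s u \<otimes> word_value G s v"
proof (induction u)
  case Nil
  then show ?case using word_value_closed[of s v] by (simp add: word_value_def)
next
  case (Cons a u)
  have "s a \<in> carrier G" using Cons.prems by blast
  then show ?case
    using Cons word_value_closed[of s u] word_value_closed[of s v]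
    by (simp add: word_value_def m_assoc)
qed

lemma word_value_inv:
  assumes s: "range s \<subseteq> carrier G" and inv: "\<And>a. inv (s a) \<in> range s"
  shows "inv (word_value G s w) \<in> range (word_value G s)"
proof (induction w)
  case Nil
  have "word_value G s [] = \<one>" by (simp add: word_value_def)
  then show ?case by (metis inv_one rangeI)
next
  case (Cons a w)
  then obtain v where v: "inv (word_value G s w) = word_value G s v" by auto
  obtain b where b: "inv (s a) = s b" using inv[of a] by auto
  have sa: "s a \<in> carrier G" and sb: "s b \<in> carrier G" using s by auto
  have "word_value G s (a # w) = s a \<otimes> word_value G s w" by (simp add: word_value_def)
  then have "inv (word_value G s (a # w)) = word_value G s v \<otimes> s b"
    using sa word_value_closed[OF s] b v by (simp add: inv_mult_group)
  also have "s b = word_value G s [b]" using sb by (simp add: word_value_def)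
  also have "word_value G s v \<otimes> word_value G s [b] = word_value G s (v @ [b])"
    using s by (simp add: word_value_append)
  finally show ?case by auto
qed

lemma subgroup_range_word_value:
  assumes s: "range s \<subseteq> carrier G" and inv: "\<And>a. inv (s a) \<in> range s"
  shows "subgroup (range (word_value G s)) G"
proof (rule subgroupI)
  show "range (word_value G s) \<subseteq> carrier G" using word_value_closed[OF s] by blast
  show "inv a \<in> range (word_value G s)" if "a \<in> range (word_value G s)" for a
    using that word_value_inv[OF assms] by auto
  show "a \<otimes> b \<in> range (word_value G s)"
    if "a \<in> range (word_value G s)" "b \<in> range (word_value G s)" for a b
    using that by (auto simp: word_value_append[OF s, symmetric])
qed auto

lemma range_subset_range_word_value:
  assumes s: "range s \<subseteq> carrier G"
  shows "range s \<subseteq> range (word_value G s)"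
proof clarify
  fix a
  have "s a \<in> carrier G" using s by blast
  then have "s a = word_value G s [a]" by (simp add: word_value_def)
  then show "s a \<in> range (word_value G s)" by auto
qed

end

text \<open>
  A subgroup covered by the type \<open>'w\<close> has a copy carried by a subset of \<open>'w\<close>.  The last property
  is stated for two domain types because obtained facts are not type-polymorphic.
\<close>

lemma topological_group_copy:
  fixes H :: "('h, 'm) monoid_scheme" and p :: "'w \<Rightarrow> 'h"
  assumes "topological_group H S" and K: "subgroup (range p) H"
  obtains H' :: "'w monoid" and S' e
  where "topological_group H' S'" "comm_group H \<Longrightarrow> comm_group H'"
    "\<And>k. k \<in> range p \<Longrightarrow> p (e k) = k"
    "p \<in> hom H' H" "continuous_map S' S p"
    "\<And>(F :: ('f, 'n) monoid_scheme) f.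
       f \<in> hom F H \<Longrightarrow> f ` carrier F \<subseteq> range p \<Longrightarrow> (\<lambda>x. e (f x)) \<in> hom F H'"
    "\<And>(Z :: 'z topology) f.
       continuous_map Z S f \<Longrightarrow> f ` topspace Z \<subseteq> range p \<Longrightarrow> continuous_map Z S' (\<lambda>x. e (f x))"
    "\<And>(Z :: 'y topology) f.
       continuous_map Z S f \<Longrightarrow> f ` topspace Z \<subseteq> range p \<Longrightarrow> continuous_map Z S' (\<lambda>x. e (f x))"
proof -
  interpret H: topological_group H S by fact
  interpret K: subgroup "range p" H by fact
  define e where "e = inv_into UNIV p"
  have pe: "p (e k) = k" if "k \<in> range p" for k
    using that by (simp add: e_def f_inv_into_f)
  define C where "C = e ` range p"
  define H' where "H' = \<lparr>carrier = C, mult = \<lambda>a b. e (p a \<otimes>\<^bsub>H\<^esub> p b), one = e \<one>\<^bsub>H\<^esub>\<rparr>"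
  define S' where "S' = pullback_topology C p S"
  have ep: "e (p c) = c" if "c \<in> C" for c using that pe by (auto simp: C_def)
  have eC: "e k \<in> C" if "k \<in> range p" for k using that by (auto simp: C_def)
  have pc[simp]: "p w \<in> carrier H" for w using K.subset by auto
  have H'simps: "carrier H' = C" "\<And>a b. a \<otimes>\<^bsub>H'\<^esub> b = e (p a \<otimes>\<^bsub>H\<^esub> p b)" "\<one>\<^bsub>H'\<^esub> = e \<one>\<^bsub>H\<^esub>"
    by (auto simp: H'_def)
  have mem: "p a \<otimes>\<^bsub>H\<^esub> p b \<in> range p" "inv\<^bsub>H\<^esub> (p a) \<in> range p" "\<one>\<^bsub>H\<^esub> \<in> range p" for a b
    by (auto intro: K.m_closed K.m_inv_closed)
  have grp: "group H'"
  proof (rule groupI)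
    show "\<exists>y\<in>carrier H'. y \<otimes>\<^bsub>H'\<^esub> x = \<one>\<^bsub>H'\<^esub>" if "x \<in> carrier H'" for x
      by (rule bexI[of _ "e (inv\<^bsub>H\<^esub> (p x))"]) (auto simp: H'simps pe mem intro: eC)
  qed (auto simp: H'simps pe mem ep H.m_assoc intro: eC)
  have p_hom: "p \<in> hom H' H"
    by (auto simp: hom_def H'simps pe mem)
  have inv_eq: "inv\<^bsub>H'\<^esub> x = e (inv\<^bsub>H\<^esub> (p x))" if "x \<in> C" for x
    using that by (intro group.inv_equality[OF grp]) (auto simp: H'simps pe mem intro: eC)
  have top: "topspace S' = C"
    using H.topspace_eq_carrier by (auto simp: S'_def topspace_pullback_topology)
  have p_cont: "continuous_map S' S p"
  proof -
    have "continuous_map S' S (id \<circ> p)"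
      unfolding S'_def by (intro continuous_map_pullback continuous_map_id)
    then show ?thesis by simp
  qed
  have e_cont: "continuous_map Z S' (\<lambda>x. e (f x))"
    if "continuous_map Z S f" "f ` topspace Z \<subseteq> range p" for Z :: "'v topology" and f
    unfolding S'_def
  proof (rule continuous_map_pullback')
    have "p (e (f x)) = f x" if "x \<in> topspace Z" for x
      using \<open>f ` topspace Z \<subseteq> range p\<close> that by (intro pe) (meson image_subset_iff)
    then have "continuous_map Z S (\<lambda>x. p (e (f x)))"
      by (intro continuous_map_eq[OF that(1)]) simp
    then show "continuous_map Z S (p \<circ> (\<lambda>x. e (f x)))" by (simp add: o_def)
    show "topspace Z \<subseteq> (\<lambda>x. e (f x)) -` C" using that(2) eC by auto
  qed
  have tg: "topological_group H' S'"
  proof (intro topological_group.intro topological_group_axioms.intro grp)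
    show "topspace S' = carrier H'" by (simp add: top H'simps)
    have "continuous_map (prod_topology S' S') S ((\<lambda>(x, y). x \<otimes>\<^bsub>H\<^esub> y) \<circ> (\<lambda>z. (p (fst z), p (snd z))))"
      by (rule continuous_map_compose[OF _ H.continuous_mult])
        (intro continuous_map_pairedI continuous_map_compose[OF _ p_cont, unfolded o_def]
           continuous_map_fst continuous_map_snd)
    then have "continuous_map (prod_topology S' S') S (\<lambda>z. p (fst z) \<otimes>\<^bsub>H\<^esub> p (snd z))"
      by (simp add: o_def)
    then have "continuous_map (prod_topology S' S') S' (\<lambda>z. e (p (fst z) \<otimes>\<^bsub>H\<^esub> p (snd z)))"
      by (intro e_cont) (auto simp: mem)
    then show "continuous_map (prod_topology S' S') S' (\<lambda>(x, y). x \<otimes>\<^bsub>H'\<^esub> y)"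
      by (simp add: H'simps case_prod_unfold)
    have "continuous_map S' S (\<lambda>x. inv\<^bsub>H\<^esub> (p x))"
      using continuous_map_compose[OF p_cont H.continuous_inv] by (simp add: o_def)
    then have "continuous_map S' S' (\<lambda>x. e (inv\<^bsub>H\<^esub> (p x)))"
      by (intro e_cont) (auto simp: mem)
    then show "continuous_map S' S' (\<lambda>x. inv\<^bsub>H'\<^esub> x)"
      by (rule continuous_map_eq) (simp add: top inv_eq)
  qed
  have comm: "comm_group H'" if "comm_group H"
  proof -
    interpret cH: comm_group H by fact
    show ?thesis
      by (rule group.group_comm_groupI[OF grp]) (simp add: H'simps cH.m_comm)
  qed
  have e_hom: "(\<lambda>x. e (f x)) \<in> hom F H'"
    if "f \<in> hom F H" "f ` carrier F \<subseteq> range p" for F :: "('f, 'n) monoid_scheme" and f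
    using that by (auto simp: hom_def H'simps pe image_subset_iff intro: eC)
  show thesis
    by (rule that[OF tg comm pe p_hom p_cont e_hom]) (use e_cont in auto)
qed

lemma extends_to_hom_universal:
  fixes X :: "'x topology" and F :: "('f, 'm) monoid_scheme" and H :: "('h, 'n) monoid_scheme"
  assumes F: "topological_group F T" and i: "inj_on i (topspace X)" "i ` topspace X \<subseteq> carrier F"
    and H: "topological_group H S" and \<phi>: "continuous_map X S \<phi>"
    and up: "\<And>(H' :: ('f \<times> bool) list monoid) S' \<psi>. topological_group H' S' \<Longrightarrow>
      (comm_group H \<Longrightarrow> comm_group H') \<Longrightarrow> continuous_map X S' \<psi> \<Longrightarrow>
      \<exists>!\<Phi>. extends_to_hom X F T i H' S' \<psi> \<Phi>"
  shows "\<exists>!\<Phi>. extends_to_hom X F T i H S \<phi> \<Phi>"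
proof (rule ex_ex1I)
  interpret F: topological_group F T by fact
  interpret H: topological_group H S by fact
  have \<phi>_in: "\<phi> x \<in> carrier H" if "x \<in> topspace X" for x
    using that \<phi> H.topspace_eq_carrier by (auto simp: continuous_map_def)
  show "\<exists>\<Phi>. extends_to_hom X F T i H S \<phi> \<Phi>"
  proof -
    define s where "s = (\<lambda>(f, b). if f \<in> i ` topspace X
        then (if b then \<phi> (inv_into (topspace X) i f) else inv\<^bsub>H\<^esub> \<phi> (inv_into (topspace X) i f))
        else \<one>\<^bsub>H\<^esub>)"
    have s: "range s \<subseteq> carrier H"
      using \<phi>_in i by (auto simp: s_def)
    have s_inv: "inv\<^bsub>H\<^esub> (s a) \<in> range s" for a
    proof -
      have "inv\<^bsub>H\<^esub> (s a) = s (fst a, \<not> snd a)"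
        using \<phi>_in i by (auto simp: s_def split: prod.splits)
      then show ?thesis by auto
    qed
    obtain H' :: "('f \<times> bool) list monoid" and S' e where H':
        "topological_group H' S'" "comm_group H \<Longrightarrow> comm_group H'"
      and pe: "\<And>k. k \<in> range (word_value H s) \<Longrightarrow> word_value H s (e k) = k"
      and p: "word_value H s \<in> hom H' H" "continuous_map S' S (word_value H s)"
      and e: "\<And>f. continuous_map X S f \<Longrightarrow> f ` topspace X \<subseteq> range (word_value H s) \<Longrightarrow>
        continuous_map X S' (\<lambda>x. e (f x))"
      by (rule topological_group_copy[OF H H.subgroup_range_word_value[OF s s_inv],
            where ?'z='x and ?'y='f and ?'f='f and ?'n='m]) (rule that; assumption)
    have \<phi>_range: "\<phi> x \<in> range (word_value H s)" if "x \<in> topspace X" for x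
    proof -
      have "\<phi> x = s (i x, True)" using that i by (simp add: s_def)
      then show ?thesis using H.range_subset_range_word_value[OF s] by auto
    qed
    then have "continuous_map X S' (\<lambda>x. e (\<phi> x))" by (intro e \<phi>) auto
    from ex1_implies_ex[OF up[OF H' this]]
    obtain \<Psi> where \<Psi>: "extends_to_hom X F T i H' S' (\<lambda>x. e (\<phi> x)) \<Psi>" by blast
    have "extends_to_hom X F T i H S \<phi> (\<lambda>f\<in>carrier F. word_value H s (\<Psi> f))"
      unfolding extends_to_hom_def
    proof (intro conjI ballI)
      show "(\<lambda>f\<in>carrier F. word_value H s (\<Psi> f)) \<in> hom F H"
        using \<Psi> p(1) by (auto simp: extends_to_hom_def hom_def Pi_iff)
      have "continuous_map T S (\<lambda>f. word_value H s (\<Psi> f))"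
        using \<Psi> p(2) by (auto simp: extends_to_hom_def dest: continuous_map_compose simp: o_def)
      then show "continuous_map T S (\<lambda>f\<in>carrier F. word_value H s (\<Psi> f))"
        by (rule continuous_map_eq) (simp add: F.topspace_eq_carrier)
      show "(\<lambda>f\<in>carrier F. word_value H s (\<Psi> f)) (i x) = \<phi> x" if "x \<in> topspace X" for x
        using that \<Psi> i pe \<phi>_range by (auto simp: extends_to_hom_def)
    qed auto
    then show ?thesis by blast
  qed
  show "\<Phi>1 = \<Phi>2"
    if \<Phi>1: "extends_to_hom X F T i H S \<phi> \<Phi>1" and \<Phi>2: "extends_to_hom X F T i H S \<phi> \<Phi>2" for \<Phi>1 \<Phi>2
  proof -
    have homs: "group_hom F H \<Phi>1" "group_hom F H \<Phi>2"
      using \<Phi>1 \<Phi>2 by (auto simp: extends_to_hom_def group_hom_def group_hom_axioms_def)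
    interpret h1: group_hom F H \<Phi>1 by fact
    interpret h2: group_hom F H \<Phi>2 by fact
    define s where "s = (\<lambda>(f, b). if f \<in> carrier F then (if b then \<Phi>1 f else \<Phi>2 f) else \<one>\<^bsub>H\<^esub>)"
    have s: "range s \<subseteq> carrier H"
      by (auto simp: s_def)
    have s_inv: "inv\<^bsub>H\<^esub> (s a) \<in> range s" for a
    proof -
      have "inv\<^bsub>H\<^esub> (s a) = s (if fst a \<in> carrier F then inv\<^bsub>F\<^esub> (fst a) else fst a, snd a)"
        by (auto simp: s_def split: prod.splits)
      then show ?thesis by auto
    qed
    obtain H' :: "('f \<times> bool) list monoid" and S' e where H':
        "topological_group H' S'" "comm_group H \<Longrightarrow> comm_group H'"
      and pe: "\<And>k. k \<in> range (word_value H s) \<Longrightarrow> word_value H s (e k) = k"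
      and e_hom: "\<And>f. f \<in> hom F H \<Longrightarrow> f ` carrier F \<subseteq> range (word_value H s) \<Longrightarrow>
        (\<lambda>x. e (f x)) \<in> hom F H'"
      and e: "\<And>f. continuous_map X S f \<Longrightarrow> f ` topspace X \<subseteq> range (word_value H s) \<Longrightarrow>
        continuous_map X S' (\<lambda>x. e (f x))"
      and e': "\<And>f. continuous_map T S f \<Longrightarrow> f ` topspace T \<subseteq> range (word_value H s) \<Longrightarrow>
        continuous_map T S' (\<lambda>x. e (f x))"
      by (rule topological_group_copy[OF H H.subgroup_range_word_value[OF s s_inv],
            where ?'z='x and ?'y='f and ?'f='f and ?'n='m]) (rule that; assumption)
    have \<Phi>_range: "\<Phi>1 f \<in> range (word_value H s)" "\<Phi>2 f \<in> range (word_value H s)"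
      if "f \<in> carrier F" for f
    proof -
      have "\<Phi>1 f = s (f, True)" "\<Phi>2 f = s (f, False)" using that by (auto simp: s_def)
      then show "\<Phi>1 f \<in> range (word_value H s)" "\<Phi>2 f \<in> range (word_value H s)"
        using H.range_subset_range_word_value[OF s] by auto
    qed
    have \<phi>_eq: "\<phi> x = \<Phi>1 (i x)" if "x \<in> topspace X" for x
      using that \<Phi>1 by (simp add: extends_to_hom_def)
    have "continuous_map X S' (\<lambda>x. e (\<phi> x))"
      by (intro e \<phi>) (use \<phi>_eq \<Phi>_range i in auto)
    note unique = up[OF H' this]
    have lift: "extends_to_hom X F T i H' S' (\<lambda>x. e (\<phi> x)) (\<lambda>f\<in>carrier F. e (\<Phi> f))"
      if \<Phi>: "extends_to_hom X F T i H S \<phi> \<Phi>"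
        and rng: "\<Phi> ` carrier F \<subseteq> range (word_value H s)" for \<Phi>
      unfolding extends_to_hom_def
    proof (intro conjI ballI)
      have "(\<lambda>f. e (\<Phi> f)) \<in> hom F H'" using \<Phi> rng by (auto simp: extends_to_hom_def intro: e_hom)
      then show "(\<lambda>f\<in>carrier F. e (\<Phi> f)) \<in> hom F H'" by (auto simp: hom_def)
      have "continuous_map T S' (\<lambda>f. e (\<Phi> f))"
        using \<Phi> rng by (intro e') (auto simp: extends_to_hom_def F.topspace_eq_carrier)
      then show "continuous_map T S' (\<lambda>f\<in>carrier F. e (\<Phi> f))"
        by (rule continuous_map_eq) (simp add: F.topspace_eq_carrier)
      show "(\<lambda>f\<in>carrier F. e (\<Phi> f)) (i x) = e (\<phi> x)" if "x \<in> topspace X" for x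
        using that \<Phi> i by (auto simp: extends_to_hom_def)
    qed auto
    have "(\<lambda>f\<in>carrier F. e (\<Phi>1 f)) = (\<lambda>f\<in>carrier F. e (\<Phi>2 f))"
    proof -
      have "\<Phi>1 ` carrier F \<subseteq> range (word_value H s)" "\<Phi>2 ` carrier F \<subseteq> range (word_value H s)"
        using \<Phi>_range by auto
      then show ?thesis using unique lift[OF \<Phi>1] lift[OF \<Phi>2] by blast
    qed
    then have "e (\<Phi>1 f) = e (\<Phi>2 f)" if "f \<in> carrier F" for f
      using that by (metis restrict_apply')
    then have "\<Phi>1 f = \<Phi>2 f" if "f \<in> carrier F" for f
      using that \<Phi>_range pe by metis
    then show ?thesis
      using \<Phi>1 \<Phi>2 by (auto simp: extends_to_hom_def intro: extensionalityI)
  qed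
qed

lemma embedding_map_into_carrier:
  assumes "topological_group F T" "embedding_map X T i"
  shows "inj_on i (topspace X)" "i ` topspace X \<subseteq> carrier F"
proof -
  interpret topological_group F T by fact
  have hom: "homeomorphic_map X (subtopology T (i ` topspace X)) i"
    using assms(2) by (simp add: embedding_map_def)
  show "inj_on i (topspace X)" using homeomorphic_imp_injective_map[OF hom] .
  show "i ` topspace X \<subseteq> carrier F"
    using homeomorphic_imp_surjective_map[OF hom] topspace_eq_carrier
    by (metis inf_le1 topspace_subtopology)
qed

theorem free_topological_group_universal:
  fixes X :: "'a topology" and F :: "('b, 'm) monoid_scheme" and H :: "('h, 'n) monoid_scheme"
  assumes free: "free_topological_group X F T i"
    and H: "topological_group H S" "continuous_map X S \<phi>"
  shows "\<exists>!\<Phi>. extends_to_hom X F T i H S \<phi> \<Phi>"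
proof -
  have F: "topological_group F T" and i: "embedding_map X T i"
    using free unfolding free_topological_group_def by blast+
  have up: "topological_group H' S' \<Longrightarrow> continuous_map X S' \<psi> \<Longrightarrow> \<exists>!\<Phi>. extends_to_hom X F T i H' S' \<psi> \<Phi>"
    for H' :: "('b \<times> bool) list monoid" and S' \<psi>
    using free unfolding free_topological_group_def by blast
  show ?thesis
    by (rule extends_to_hom_universal[OF F embedding_map_into_carrier[OF F i] H(1) H(2)])
      (simp add: up)
qed

theorem free_abelian_topological_group_universal:
  fixes X :: "'a topology" and F :: "('b, 'm) monoid_scheme" and H :: "('h, 'n) monoid_scheme"
  assumes free: "free_abelian_topological_group X F T i"
    and H: "topological_group H S" "comm_group H" "continuous_map X S \<phi>"
  shows "\<exists>!\<Phi>. extends_to_hom X F T i H S \<phi> \<Phi>"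
proof -
  have F: "topological_group F T" and i: "embedding_map X T i"
    using free unfolding free_abelian_topological_group_def by blast+
  have up: "topological_group H' S' \<Longrightarrow> comm_group H' \<Longrightarrow> continuous_map X S' \<psi> \<Longrightarrow> \<exists>!\<Phi>. extends_to_hom X F T i H' S' \<psi> \<Phi>"
    for H' :: "('b \<times> bool) list monoid" and S' \<psi>
    using free unfolding free_abelian_topological_group_def by blast
  show ?thesis
    by (rule extends_to_hom_universal[OF F embedding_map_into_carrier[OF F i] H(1) H(3)])
      (simp add: up H(2))
qed


section \<open>Scheepers spaces\<close>

definition tychonov_space :: "'a topology \<Rightarrow> bool"
  where "tychonov_space X \<longleftrightarrow> completely_regular_space X \<and> Hausdorff_space X"

definition open_cover :: "'a topology \<Rightarrow> 'a set set \<Rightarrow> bool"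
  where "open_cover X \<U> \<longleftrightarrow> (\<forall>U\<in>\<U>. openin X U) \<and> \<Union>\<U> = topspace X"

definition omega_cover :: "'a set \<Rightarrow> 'a set set \<Rightarrow> bool"
  where "omega_cover X \<U> \<longleftrightarrow> \<Union>\<U> = X \<and> (\<forall>F. finite F \<and> F \<subseteq> X \<longrightarrow> (\<exists>U\<in>\<U>. F \<subseteq> U))"

definition Scheepers_space :: "'a topology \<Rightarrow> bool"
  where "Scheepers_space X \<longleftrightarrow>
    (\<forall>\<U> :: nat \<Rightarrow> 'a set set. (\<forall>n. open_cover X (\<U> n)) \<longrightarrow>
      (\<exists>\<V> :: nat \<Rightarrow> 'a set set. (\<forall>n. finite (\<V> n) \<and> \<V> n \<subseteq> \<U> n) \<and>
        omega_cover (topspace X) (range (\<lambda>n. \<Union>(\<V> n)))))"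

definition continuous_metrizable_image :: "'a topology \<Rightarrow> 'b topology \<Rightarrow> bool"
  where "continuous_metrizable_image X Y \<longleftrightarrow>
    metrizable_space Y \<and> (\<exists>f. continuous_map X Y f \<and> f ` topspace X = topspace Y)"

lemma Scheepers_continuous_image:
  assumes X: "Scheepers_space X" and f: "continuous_map X Y f" "f ` topspace X = topspace Y"
  shows "Scheepers_space Y"
  unfolding Scheepers_space_def
proof (intro allI impI)
  fix \<U> :: "nat \<Rightarrow> 'b set set"
  assume \<U>: "\<forall>n. open_cover Y (\<U> n)"
  define g where "g U = {x \<in> topspace X. f x \<in> U}" for U
  have "open_cover X (g ` \<U> n)" for n
  proof -
    have "\<Union> (g ` \<U> n) = topspace X"
    proof
      show "\<Union> (g ` \<U> n) \<subseteq> topspace X" by (auto simp: g_def)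
      show "topspace X \<subseteq> \<Union> (g ` \<U> n)"
      proof
        fix x assume x: "x \<in> topspace X"
        then have "f x \<in> \<Union> (\<U> n)" using \<U> f(2) by (auto simp: open_cover_def)
        then show "x \<in> \<Union> (g ` \<U> n)" using x by (auto simp: g_def)
      qed
    qed
    then show ?thesis
      using \<U> f(1) unfolding open_cover_def g_def by (auto intro: openin_continuous_map_preimage)
  qed
  then have "\<forall>n. open_cover X (g ` \<U> n)" by blast
  from X[unfolded Scheepers_space_def, THEN spec[of _ "\<lambda>n. g ` \<U> n"], THEN mp, OF this]
  obtain \<V> where \<V>_all: "\<forall>n. finite (\<V> n) \<and> \<V> n \<subseteq> g ` \<U> n"
    and \<V>_omega: "omega_cover (topspace X) (range (\<lambda>n. \<Union>(\<V> n)))"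
    by (elim exE conjE)
  note \<V> = \<V>_all[rule_format, THEN conjunct1] \<V>_all[rule_format, THEN conjunct2] \<V>_omega
  have "\<exists>W. W \<subseteq> \<U> n \<and> finite W \<and> \<V> n = g ` W" for n
    using finite_subset_image[OF \<V>(1,2)] by blast
  then obtain W where W: "\<And>n. W n \<subseteq> \<U> n" "\<And>n. finite (W n)" "\<And>n. \<V> n = g ` W n"
    by metis
  have W_sub: "\<Union>(W n) \<subseteq> topspace Y" for n
    using W(1) \<U> unfolding open_cover_def by blast
  have fin: "\<exists>n. K \<subseteq> \<Union>(W n)" if K: "finite K" "K \<subseteq> topspace Y" for K
  proof -
    obtain L where L: "L \<subseteq> topspace X" "finite L" "K = f ` L"
      using finite_subset_image[OF K(1)] K(2) f(2) by metis
    then obtain n where "L \<subseteq> \<Union>(\<V> n)"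
      using \<V>(3) unfolding omega_cover_def by blast
    then have "K \<subseteq> \<Union>(W n)" using L(3) unfolding W(3) g_def by blast
    then show ?thesis ..
  qed
  have "topspace Y \<subseteq> (\<Union>n. \<Union>(W n))"
  proof
    fix y assume "y \<in> topspace Y"
    then show "y \<in> (\<Union>n. \<Union>(W n))" using fin[of "{y}"] by auto
  qed
  with W_sub have "\<Union>(range (\<lambda>n. \<Union>(W n))) = topspace Y" by (intro equalityI UN_least)
  then have "omega_cover (topspace Y) (range (\<lambda>n. \<Union>(W n)))"
    using fin by (simp add: omega_cover_def)
  with W(1,2) show
    "\<exists>\<V>. (\<forall>n. finite (\<V> n) \<and> \<V> n \<subseteq> \<U> n) \<and> omega_cover (topspace Y) (range (\<lambda>n. \<Union>(\<V> n)))"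
    by (intro exI[of _ W] conjI allI)
qed

text \<open>
  A continuous image of \<open>X\<close> is homeomorphic to one whose points are points of \<open>X\<close>, so images
  carried by the type of \<open>X\<close> decide the property for images of every type.
\<close>

lemma continuous_metrizable_images_Scheepers:
  fixes X :: "'a topology" and Y :: "'b topology"
  assumes all: "\<And>Z :: 'a topology. continuous_metrizable_image X Z \<Longrightarrow> Scheepers_space Z"
    and Y: "continuous_metrizable_image X Y"
  shows "Scheepers_space Y"
proof -
  obtain f where f: "continuous_map X Y f" "f ` topspace X = topspace Y" and "metrizable_space Y"
    using Y unfolding continuous_metrizable_image_def by blast
  define e where "e = inv_into (topspace X) f"
  define C where "C = e ` topspace Y"
  define Z where "Z = pullback_topology C f Y"
  have fe: "f (e y) = y" if "y \<in> topspace Y" for y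
    using that f(2) by (simp add: e_def f_inv_into_f)
  have top: "topspace Z = C"
    by (auto simp: Z_def C_def topspace_pullback_topology fe)
  have f_cont: "continuous_map Z Y f"
  proof -
    have "continuous_map Z Y (id \<circ> f)"
      unfolding Z_def by (intro continuous_map_pullback continuous_map_id)
    then show ?thesis by simp
  qed
  have "continuous_map Y Y (f \<circ> e)"
    by (rule continuous_map_eq[OF continuous_map_id]) (simp add: fe)
  then have e_cont: "continuous_map Y Z e"
    unfolding Z_def by (rule continuous_map_pullback') (auto simp: C_def)
  have f_surj: "f ` topspace Z = topspace Y"
    by (auto simp: top C_def fe image_iff)
  have "homeomorphic_maps Z Y f e"
    by (auto simp: homeomorphic_maps_def f_cont e_cont fe top C_def)
  then have "Z homeomorphic_space Y" unfolding homeomorphic_space_def by blast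
  then have "metrizable_space Z" using \<open>metrizable_space Y\<close> homeomorphic_metrizable_space by blast
  moreover have "continuous_map X Z (e \<circ> f)"
    using f(1) e_cont by (rule continuous_map_compose)
  moreover have "(e \<circ> f) ` topspace X = topspace Z"
    by (simp only: image_comp[symmetric] f(2) top C_def)
  ultimately have "Scheepers_space Z"
    by (intro all) (unfold continuous_metrizable_image_def, blast)
  then show ?thesis using f_cont f_surj by (rule Scheepers_continuous_image)
qed

end

theory Submission
  imports Defs "HOL-Probability.Discrete_Topology"
begin

text \<open>
  Condition (1) gives (2) by projecting the first power of \<open>F(X)\<close> to \<open>F(X)\<close>, and (2) gives (3)
  because \<open>A(X)\<close> is a continuous homomorphic image of \<open>F(X)\<close>; both groups are generated by \<open>X\<close>
  (\<open>carrier_eq_generate_of_universal\<close>), which the universal property yields through the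
  uniqueness of extensions.

  From (3) to (4), let \<open>\<U>\<close> be an open cover of a metrizable image \<open>Y\<close> of \<open>X\<close>.  There is an
  equicontinuous family of functions \<open>h \<V>\<close> with values in \<open>[0, 1]\<close>, indexed by the subfamilies
  \<open>\<V>\<close> of \<open>\<U>\<close>, such that \<open>h \<V>\<close> vanishes at any given point once \<open>\<V>\<close> contains a suitable member of
  \<open>\<U>\<close>, while \<open>h \<V> y < 1\<close> forces \<open>y \<in> \<Union>\<V>\<close>.  Equicontinuity makes \<open>y \<mapsto> (h \<V> y)\<^sub>\<V>\<close> a continuous map into
  a Banach space of bounded functions, so it extends to a continuous homomorphism \<open>\<Phi>\<close> on \<open>A(X)\<close>.  The open unit
  ball pulls back to a neighborhood of zero in \<open>A(X)\<close>.  If a sum \<open>x\<^sub>1 + \<dots> + x\<^sub>k\<close> of points lies in a translate of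
  it by \<open>c\<close>, then choose a finite \<open>\<V>\<close> for which the \<open>\<V>\<close>-coordinate of \<open>\<Phi>(c)\<close> is zero: the numbers \<open>h \<V>\<close> at the
  points are nonnegative with sum below 1, hence every point lies in \<open>\<Union>\<V>\<close>.  Thus finitely many
  translates determine finitely many members of the cover, and o-boundedness of \<open>A(X)\<close> becomes
  the Scheepers property of \<open>Y\<close> (\<open>free_abelian_o_bounded_imp_Scheepers\<close>).

  From (4) to (1), a sequence of neighborhoods of the identity defines, on \<open>X\<close>, a normal sequence of
  entourages, hence a continuous pseudometric; its metric quotient is a Scheepers space.  So the
  generators of the group form a Scheepers-bounded set \<open>Y\<close>: for neighborhoods \<open>V\<^sub>n\<close> there are
  finite sets \<open>E\<^sub>n\<close> such that every finite subset of \<open>Y\<close> lies in \<open>V\<^sub>n E\<^sub>n\<close> for infinitely many \<open>n\<close>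
  (\<open>Scheepers_bounded_union_of_images\<close>).  It remains to pass from generators to words
  \<open>y\<^sub>1 \<cdots> y\<^sub>k\<close>.  If \<open>y\<^sub>1 = w\<^sub>1 a\<^sub>1\<close> and \<open>y\<^sub>2 = w\<^sub>2 a\<^sub>2\<close>, then
  \<open>y\<^sub>1 y\<^sub>2 = w\<^sub>1 (a\<^sub>1 w\<^sub>2 a\<^sub>1\<inverse>) a\<^sub>1 a\<^sub>2\<close>, so the neighborhood used for the second letter has to be small
  with respect to conjugation by the element chosen for the first one.  One therefore approximates
  the letters at different indices \<open>n\<^sub>1 < \<dots> < n\<^sub>k\<close>, and lets \<open>V\<^sub>n\<close> be small under conjugation by the
  products of the first \<open>n\<close> members of the countable lists chosen at earlier indices
  (\<open>conjugation_telescope\<close>).  This works if the bound \<open>g(n\<^sub>i)\<close> for the position in the list used at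
  \<open>n\<^sub>i\<close> is at most \<open>n\<^sub>i\<^sub>+\<^sub>1\<close>.

  For a single neighborhood \<open>U\<^sub>b\<close> only finitely many translates are available, so the indices
  \<open>n\<^sub>1, \<dots>, n\<^sub>k\<close> must come from a finite block of integers fixed in advance, although the set of
  good indices depends on the word.  Finite intersections of sets of good indices are infinite, so
  these sets belong to a common free ultrafilter.  Integers are collapsed to intervals so long that
  nonadjacent ones are \<open>g\<close>-separated.  The image ultrafilter is not a Q-point, so there is a
  finite-to-one map whose fibers meet each of its sets in arbitrarily many points; pulled back to
  the integers, those fibers are the blocks (\<open>no_Q_point_sparse_blocks\<close>).  The argument applies to
  any group generated by finitely many continuous images of \<open>X\<close>, in particular to all finite powers
  of \<open>F(X)\<close>.
\<close>


section \<open>Ultrafilters and Q-points\<close>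

lemma free_ultrafilter_extending:
  fixes S :: "'a set set"
  assumes S: "\<And>K. finite K \<Longrightarrow> K \<subseteq> S \<Longrightarrow> infinite (\<Inter>K)"
  obtains U where "free_ultrafilter U" "\<And>A. A \<in> S \<Longrightarrow> eventually (\<lambda>x. x \<in> A) U"
proof -
  define \<FF> where "\<FF> = {F :: 'a set set. S \<subseteq> F \<and> (\<forall>K. finite K \<and> K \<subseteq> F \<longrightarrow> infinite (\<Inter>K))}"
  \<comment> \<open>A maximal family all of whose finite intersections are infinite is a free ultrafilter.\<close>
  have "\<exists>M\<in>\<FF>. \<forall>F\<in>\<FF>. M \<subseteq> F \<longrightarrow> F = M"
  proof (rule subset_Zorn_nonempty)
    show "\<FF> \<noteq> {}" using S by (auto simp: \<FF>_def)
    fix C assume C: "C \<noteq> {}" "subset.chain \<FF> C"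
    have "infinite (\<Inter>K)" if K: "finite K" "K \<subseteq> \<Union>C" for K
    proof -
      obtain F where "F \<in> C" "K \<subseteq> F"
        using finite_subset_Union_chain[OF K C] by blast
      then show ?thesis using C(2) K(1) unfolding subset.chain_def \<FF>_def by blast
    qed
    moreover have "S \<subseteq> \<Union>C"
    proof -
      obtain F where "F \<in> C" using C(1) by blast
      moreover from this have "S \<subseteq> F" using C(2) unfolding subset.chain_def \<FF>_def by blast
      ultimately show ?thesis by blast
    qed
    ultimately show "\<Union>C \<in> \<FF>" by (simp add: \<FF>_def)
  qed
  then obtain M where M: "M \<in> \<FF>" and max: "\<And>F. F \<in> \<FF> \<Longrightarrow> M \<subseteq> F \<Longrightarrow> F = M" by blast
  have inf: "infinite (\<Inter>K)" if "finite K" "K \<subseteq> M" for K using that M by (auto simp: \<FF>_def)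
  have memI: "B \<in> M" if B: "\<And>K. finite K \<Longrightarrow> K \<subseteq> M \<Longrightarrow> infinite (B \<inter> \<Inter>K)" for B
  proof -
    have "infinite (\<Inter>K)" if K: "finite K" "K \<subseteq> insert B M" for K
    proof -
      have "infinite (B \<inter> \<Inter>(K - {B}))" using K by (intro B) auto
      moreover have "B \<inter> \<Inter>(K - {B}) \<subseteq> \<Inter>K" by auto
      ultimately show ?thesis using infinite_super by blast
    qed
    then have "insert B M \<in> \<FF>" using M by (auto simp: \<FF>_def)
    then show ?thesis using max by blast
  qed
  have up: "B \<in> M" if "A \<in> M" "A \<subseteq> B" for A B
  proof (rule memI)
    fix K assume K: "finite K" "K \<subseteq> M"
    have "infinite (\<Inter>(insert A K))" using K that by (intro inf) auto
    moreover have "\<Inter>(insert A K) \<subseteq> B \<inter> \<Inter>K" using that by auto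
    ultimately show "infinite (B \<inter> \<Inter>K)" using infinite_super by blast
  qed
  have int: "A \<inter> B \<in> M" if "A \<in> M" "B \<in> M" for A B
  proof (rule memI)
    fix K assume K: "finite K" "K \<subseteq> M"
    have "infinite (\<Inter>({A, B} \<union> K))" using K that by (intro inf) auto
    then show "infinite (A \<inter> B \<inter> \<Inter>K)" by (simp add: Int_assoc)
  qed
  have ultra: "A \<in> M \<or> - A \<in> M" for A
  proof (rule ccontr)
    assume "\<not> ?thesis"
    then obtain K L where K: "finite K" "K \<subseteq> M" "finite (A \<inter> \<Inter>K)"
      and L: "finite L" "L \<subseteq> M" "finite (- A \<inter> \<Inter>L)" using memI by meson
    have "infinite (\<Inter>(K \<union> L))" using K L by (intro inf) auto
    moreover have "\<Inter>(K \<union> L) \<subseteq> (A \<inter> \<Inter>K) \<union> (- A \<inter> \<Inter>L)" by auto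
    ultimately show False using K L infinite_super by blast
  qed
  have fin: "infinite A" if "A \<in> M" for A using inf[of "{A}"] that by simp
  define U where "U = Abs_filter (\<lambda>P. {x. P x} \<in> M)"
  have "is_filter (\<lambda>P. {x. P x} \<in> M)"
  proof
    show "{x. True} \<in> M" by (rule memI) (use inf in auto)
    show "{x. P x} \<in> M \<Longrightarrow> {x. Q x} \<in> M \<Longrightarrow> {x. P x \<and> Q x} \<in> M" for P Q
      using int by (simp add: Collect_conj_eq)
    show "\<forall>x. P x \<longrightarrow> Q x \<Longrightarrow> {x. P x} \<in> M \<Longrightarrow> {x. Q x} \<in> M" for P Q
      using up by (metis Collect_mono)
  qed
  then have U: "eventually P U \<longleftrightarrow> {x. P x} \<in> M" for P
    unfolding U_def by (rule eventually_Abs_filter)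
  show thesis
  proof
    have "U \<noteq> bot" using fin[of "{}"] by (auto simp: U trivial_limit_def)
    moreover have "eventually P U \<or> eventually (\<lambda>x. \<not> P x) U" for P
      using ultra[of "{x. P x}"] by (simp add: U Collect_neg_eq)
    moreover have "eventually (\<lambda>x. x \<noteq> a) U" for a
      using ultra[of "{a}"] fin[of "{a}"] by (auto simp: U Compl_eq)
    ultimately show "free_ultrafilter U" by (auto simp: free_ultrafilter_def ultrafilter_def)
    show "eventually (\<lambda>x. x \<in> A) U" if "A \<in> S" for A
      using that M by (auto simp: U \<FF>_def)
  qed
qed

lemma free_ultrafilter_filtermap:
  assumes U: "free_ultrafilter U" and q: "\<And>y. finite (q -` {y})"
  shows "free_ultrafilter (filtermap q U)"
proof -
  have "eventually (\<lambda>x. x \<notin> K) U" if "finite K" for K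
    using that
  proof induction
    case (insert a K)
    then show ?case using U by (auto simp: free_ultrafilter_def intro: eventually_conj)
  qed simp
  from this[OF q] have "eventually (\<lambda>x. q x \<noteq> y) U" for y by simp
  then show ?thesis using U
    by (auto simp: free_ultrafilter_def ultrafilter_def eventually_filtermap filtermap_bot_iff)
qed

text \<open>
  A map that is injective on no set of the ultrafilter has fibers meeting each such set \<open>A\<close> in
  arbitrarily many points: the least elements of \<open>A\<close> in the fibers form a set on which the map is
  injective, so removing them from \<open>A\<close> leaves a set of the ultrafilter, and induction on the number
  of points applies to what is left.
\<close>

lemma not_Q_point_large_fibres:
  fixes U :: "nat filter"
  assumes U: "free_ultrafilter U" and nQ: "\<not> Q_point U"
  obtains f :: "nat \<Rightarrow> nat" where "finite_to_one f"
    "\<And>A k. eventually (\<lambda>n. n \<in> A) U \<Longrightarrow> \<exists>y. \<exists>B \<subseteq> A \<inter> f -` {y}. finite B \<and> card B = k"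
proof -
  obtain f :: "nat \<Rightarrow> nat" where f: "finite_to_one f"
    "\<And>A. eventually (\<lambda>n. n \<in> A) U \<Longrightarrow> \<not> inj_on f A"
    using U nQ unfolding Q_point_def by blast
  have "\<exists>y. \<exists>B \<subseteq> A \<inter> f -` {y}. finite B \<and> card B = k" if "eventually (\<lambda>n. n \<in> A) U" for A k
    using that
  proof (induction k arbitrary: A)
    case 0
    show ?case by (intro exI[of _ 0] exI[of _ "{}"]) auto
  next
    case (Suc k)
    define m where "m n = (LEAST m. m \<in> A \<and> f m = f n)" for n
    define L where "L = {n \<in> A. m n = n}"
    have m: "m n \<in> A \<and> f (m n) = f n" if "n \<in> A" for n
      unfolding m_def by (rule LeastI[of _ n]) (simp add: that)
    have "inj_on f L"
    proof (rule inj_onI)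
      fix a b assume ab: "a \<in> L" "b \<in> L" "f a = f b"
      then have "m a = m b" by (simp add: m_def)
      then show "a = b" using ab by (simp add: L_def)
    qed
    then have "\<not> eventually (\<lambda>n. n \<in> L) U" using f(2) by blast
    then have "eventually (\<lambda>n. n \<notin> L) U"
      using U by (auto simp: free_ultrafilter_def ultrafilter_def)
    with Suc.prems have "eventually (\<lambda>n. n \<in> A - L) U" by eventually_elim simp
    from Suc.IH[OF this] obtain y B where B: "B \<subseteq> (A - L) \<inter> f -` {y}" "finite B" "card B = k"
      by blast
    show ?case
    proof (cases "k = 0")
      case True
      have "A \<noteq> {}" using Suc.prems U by (auto simp: free_ultrafilter_def ultrafilter_def)
      then obtain n where "n \<in> A" by blast
      then show ?thesis using True by (intro exI[of _ "f n"] exI[of _ "{n}"]) auto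
    next
      case False
      then obtain n where n: "n \<in> B" using B by fastforce
      then have nA: "n \<in> A" and fn: "f n = y" using B(1) by auto
      have "m (m n) = m n" using m[OF nA] by (simp add: m_def[of "m n"] m_def[of n, symmetric])
      then have "m n \<in> L" using m[OF nA] unfolding L_def by blast
      then have "m n \<notin> B" using B(1) by blast
      then show ?thesis using B m[OF nA] fn
        by (intro exI[of _ y] exI[of _ "insert (m n) B"]) auto
    qed
  qed
  with f(1) show thesis using that by blast
qed

text \<open>
  The map sends an integer to the number of its interval in a partition of the integers into
  intervals.  Each interval ends beyond all values of \<open>g\<close> on the preceding ones, so one full
  interval between two integers is enough to separate them with respect to \<open>g\<close>.
\<close>

lemma interval_collapse:
  fixes g :: "nat \<Rightarrow> nat"
  obtains q :: "nat \<Rightarrow> nat" where "\<And>m. finite (q -` {m})" "mono q"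
    "\<And>n n'. q n + 2 \<le> q n' \<Longrightarrow> g n \<le> n'"
proof -
  define h where "h = rec_nat 0 (\<lambda>_ a. Suc a + (\<Sum>i\<le>a. g i))"
  have h0: "h 0 = 0" and hS: "h (Suc m) = Suc (h m) + (\<Sum>i\<le>h m. g i)" for m
    by (simp_all add: h_def)
  have smono: "strict_mono h" by (rule strict_mono_Suc_iff[THEN iffD2]) (simp add: hS)
  define q where "q n = (GREATEST m. h m \<le> n)" for n
  have bd: "m \<le> n" if "h m \<le> n" for m n
    using that strict_mono_imp_increasing[OF smono, of m] by simp
  have q1: "h (q n) \<le> n" for n
    unfolding q_def by (rule GreatestI_nat[of _ 0 n]) (use h0 bd in auto)
  have q2: "m \<le> q n" if "h m \<le> n" for m n
    unfolding q_def using that bd by (intro Greatest_le_nat[of _ _ n]) auto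
  have q3: "n < h (Suc (q n))" for n
    using q2[of "Suc (q n)" n] by (meson not_less_eq_eq not_less order_refl)
  show thesis
  proof
    show "finite (q -` {m})" for m
    proof (rule finite_subset)
      show "q -` {m} \<subseteq> {..< h (Suc m)}" using q3 by auto
    qed simp
    show "mono q" using q1 q2 by (intro monoI) (meson order_trans)
    fix n n' assume "q n + 2 \<le> q n'"
    then have "h (Suc (Suc (q n))) \<le> h (q n')"
      using smono by (simp add: strict_mono_less_eq)
    moreover have "g n \<le> (\<Sum>i\<le>h (Suc (q n)). g i)"
      using q3[of n] by (intro member_le_sum) auto
    ultimately show "g n \<le> n'" using q1[of n'] by (simp only: hS)
  qed
qed

text \<open>
  The blocks \<open>p -` {b}\<close> are fibers of a map witnessing that the collapsed ultrafilter is not a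
  Q-point.  Each block is labelled by its least element, so that the label bounds every element
  from below.
\<close>

lemma no_Q_point_sparse_blocks:
  fixes S :: "nat set set" and g :: "nat \<Rightarrow> nat"
  assumes noQ: "\<not> (\<exists>U. Q_point U)" and S: "\<And>K. finite K \<Longrightarrow> K \<subseteq> S \<Longrightarrow> infinite (\<Inter>K)"
  obtains p :: "nat \<Rightarrow> nat" where "\<And>n. p n \<le> n" "\<And>b. finite (p -` {b})"
    "\<And>K k. finite K \<Longrightarrow> K \<subseteq> S \<Longrightarrow> \<exists>b ns. length ns = k \<and> set ns \<subseteq> \<Inter>K \<inter> p -` {b} \<and>
       sorted_wrt (\<lambda>n n'. n < n' \<and> g n \<le> n') ns"
proof -
  obtain U where U: "free_ultrafilter U" "\<And>A. A \<in> S \<Longrightarrow> eventually (\<lambda>x. x \<in> A) U"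
    using free_ultrafilter_extending[OF S] by blast
  obtain q :: "nat \<Rightarrow> nat" where q: "\<And>m. finite (q -` {m})" "mono q"
    "\<And>n n'. q n + 2 \<le> q n' \<Longrightarrow> g n \<le> n'" using interval_collapse[of g] by blast
  have qU: "free_ultrafilter (filtermap q U)" using U(1) q(1) by (rule free_ultrafilter_filtermap)
  obtain f :: "nat \<Rightarrow> nat" where f: "finite_to_one f"
    "\<And>A k. eventually (\<lambda>n. n \<in> A) (filtermap q U) \<Longrightarrow>
        \<exists>y. \<exists>B \<subseteq> A \<inter> f -` {y}. finite B \<and> card B = k"
    using not_Q_point_large_fibres[OF qU] noQ by blast
  define p where "p n = (LEAST n'. f (q n') = f (q n))" for n
  have fp: "f (q (p n)) = f (q n)" for n unfolding p_def by (rule LeastI) simp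
  show thesis
  proof
    show "p n \<le> n" for n unfolding p_def by (rule Least_le) simp
    show "finite (p -` {b})" for b
    proof (rule finite_subset)
      show "p -` {b} \<subseteq> q -` (f -` {f (q b)})" using fp by auto
      have "finite (f -` {f (q b)})" using f(1) by (simp add: finite_to_one_def)
      then have "finite (\<Union>m\<in>f -` {f (q b)}. q -` {m})" using q(1) by blast
      then show "finite (q -` (f -` {f (q b)}))" by (simp add: vimage_UN[symmetric])
    qed
    fix K k assume K: "finite K" "K \<subseteq> S"
    have "eventually (\<lambda>x. \<forall>A\<in>K. x \<in> A) U"
      using K U(2) by (intro eventually_ball_finite) auto
    then have AU: "eventually (\<lambda>m. m \<in> q ` \<Inter>K) (filtermap q U)"
      unfolding eventually_filtermap by eventually_elim auto
    \<comment> \<open>Restricting to one parity class makes different interval numbers nonadjacent.\<close>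
    obtain E :: "nat set" where E: "eventually (\<lambda>m. m \<in> E) (filtermap q U)"
      "\<And>m m'. m \<in> E \<Longrightarrow> m' \<in> E \<Longrightarrow> m < m' \<Longrightarrow> m + 2 \<le> m'"
    proof (cases "eventually even (filtermap q U)")
      case True
      then show thesis by (intro that[of "{m. even m}"]) (auto elim!: evenE)
    next
      case False
      then have "eventually odd (filtermap q U)"
        using qU unfolding free_ultrafilter_def ultrafilter_def by blast
      then show thesis by (intro that[of "{m. odd m}"]) (auto elim!: oddE)
    qed
    from AU E(1) have "eventually (\<lambda>m. m \<in> q ` \<Inter>K \<inter> E) (filtermap q U)"
      by eventually_elim simp
    from f(2)[OF this, of k] obtain y B where
      B: "B \<subseteq> (q ` \<Inter>K \<inter> E) \<inter> f -` {y}" "finite B" "card B = k" by blast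
    have "\<exists>n. n \<in> \<Inter>K \<and> q n = m" if "m \<in> B" for m using B(1) that by force
    then obtain r where r: "\<And>m. m \<in> B \<Longrightarrow> r m \<in> \<Inter>K \<and> q (r m) = m" by metis
    define ms where "ms = sorted_list_of_set B"
    have ms: "set ms = B" "length ms = k" "sorted_wrt (<) ms" using B(2,3) by (auto simp: ms_def)
    have "sorted_wrt (\<lambda>m m'. r m < r m' \<and> g (r m) \<le> r m') ms"
    proof (rule sorted_wrt_mono_rel[OF _ ms(3)])
      fix m m' assume m: "m \<in> set ms" "m' \<in> set ms" "m < m'"
      then have "m + 2 \<le> m'" using E(2) B(1) ms(1) by blast
      then have "g (r m) \<le> r m'" using m ms(1) r q(3) by simp
      moreover have "r m < r m'"
        using m ms(1) r q(2) by (metis monoD not_less)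
      ultimately show "r m < r m' \<and> g (r m) \<le> r m'" by simp
    qed
    then have "sorted_wrt (\<lambda>n n'. n < n' \<and> g n \<le> n') (map r ms)"
      by (simp add: sorted_wrt_map)
    moreover have "p (r m) = (LEAST n'. f (q n') = y)" if "m \<in> B" for m
      using r[OF that] B(1) that unfolding p_def by auto
    ultimately show "\<exists>b ns. length ns = k \<and> set ns \<subseteq> \<Inter>K \<inter> p -` {b} \<and>
        sorted_wrt (\<lambda>n n'. n < n' \<and> g n \<le> n') ns"
      using ms r by (intro exI[of _ "LEAST n'. f (q n') = y"] exI[of _ "map r ms"]) auto
  qed
qed


section \<open>Metrization and Scheepers spaces\<close>

text \<open>
  Frink's argument, by induction on the length of the chain.  Cutting the chain at the last point
  where the partial sum is at most half of the total leaves a left part, a single step and a right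
  part; both parts cost at most half of the total, so the induction hypothesis bounds all three
  values of \<open>f\<close> by the total, and the three-step inequality doubles this bound.
\<close>

lemma chain_sum_lower_bound:
  fixes f :: "'a \<Rightarrow> 'a \<Rightarrow> real"
  assumes nonneg: "\<And>x y. 0 \<le> f x y" and refl: "\<And>x. f x x = 0"
    and three: "\<And>s x y z w. f x y \<le> s \<Longrightarrow> f y z \<le> s \<Longrightarrow> f z w \<le> s \<Longrightarrow> f x w \<le> 2 * s"
    and "a \<le> b"
  shows "f (u a) (u b) \<le> 2 * (\<Sum>i=a..<b. f (u i) (u (Suc i)))"
  using \<open>a \<le> b\<close>
proof (induction "b - a" arbitrary: a b rule: less_induct)
  case less
  let ?s = "\<lambda>a b. \<Sum>i=a..<b. f (u i) (u (Suc i))"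
  show ?case
  proof (cases "a = b")
    case True
    then show ?thesis using refl by simp
  next
    case False
    define J where "J = {j \<in> {a..<b}. ?s a j \<le> ?s a b / 2}"
    have s0: "0 \<le> ?s i j" for i j using nonneg by (intro sum_nonneg)
    have "a \<in> J" using False less.prems s0 by (simp add: J_def)
    define j where "j = Max J"
    have "j \<in> J" unfolding j_def using \<open>a \<in> J\<close> by (intro Max_in) (auto simp: J_def)
    then have j: "a \<le> j" "j < b" "?s a j \<le> ?s a b / 2" by (auto simp: J_def)
    have "?s (Suc j) b \<le> ?s a b / 2"
    proof (cases "Suc j = b")
      case True
      then show ?thesis using s0 by simp
    next
      case False
      have "Suc j \<notin> J"
      proof
        assume "Suc j \<in> J"
        then have "Suc j \<le> j" unfolding j_def by (intro Max_ge) (auto simp: J_def)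
        then show False by simp
      qed
      then have "?s a b / 2 < ?s a (Suc j)" using False j by (auto simp: J_def)
      moreover have "?s a (Suc j) + ?s (Suc j) b = ?s a b"
        using j by (intro sum.atLeastLessThan_concat) auto
      ultimately show ?thesis by linarith
    qed
    moreover have "f (u a) (u j) \<le> 2 * ?s a j" using j by (intro less.hyps) auto
    moreover have "f (u (Suc j)) (u b) \<le> 2 * ?s (Suc j) b" using j by (intro less.hyps) auto
    moreover have "f (u j) (u (Suc j)) \<le> ?s a b"
      using j nonneg by (intro member_le_sum) auto
    ultimately show ?thesis using j(3) by (intro three[of "u a" "u j" _ "u (Suc j)" "u b"]) linarith+
  qed
qed

text \<open>
  The largest pseudometric below \<open>f\<close> is obtained as a supremum over the functions that are
  1-Lipschitz with respect to \<open>f\<close>, for which the triangle inequality is immediate.  That it is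
  large enough is seen from one such function, the cost of the cheapest chain from a fixed point.
\<close>

lemma pseudometric_between:
  fixes f :: "'a \<Rightarrow> 'a \<Rightarrow> real"
  assumes nonneg: "\<And>x y. 0 \<le> f x y" and refl: "\<And>x. f x x = 0" and sym: "\<And>x y. f x y = f y x"
    and three: "\<And>s x y z w. f x y \<le> s \<Longrightarrow> f y z \<le> s \<Longrightarrow> f z w \<le> s \<Longrightarrow> f x w \<le> 2 * s"
  obtains d where "\<And>x y. 0 \<le> d x y" "\<And>x y. d x y = d y x" "\<And>x y z. d x z \<le> d x y + d y z"
    "\<And>x y. d x y \<le> f x y" "\<And>x y. f x y \<le> 2 * d x y"
proof -
  define \<H> where "\<H> = {h :: 'a \<Rightarrow> real. \<forall>a b. \<bar>h a - h b\<bar> \<le> f a b}"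
  define d where "d x y = (SUP h\<in>\<H>. \<bar>h x - h y\<bar>)" for x y
  have H0: "(\<lambda>_. 0) \<in> \<H>" using nonneg by (simp add: \<H>_def)
  have bdd: "bdd_above ((\<lambda>h. \<bar>h x - h y\<bar>) ` \<H>)" for x y
    by (intro bdd_aboveI2[of _ _ "f x y"]) (simp add: \<H>_def)
  have le_d: "\<bar>h x - h y\<bar> \<le> d x y" if "h \<in> \<H>" for h x y
    unfolding d_def using that by (rule cSUP_upper[OF _ bdd])
  have d_le: "d x y \<le> c" if "\<And>h. h \<in> \<H> \<Longrightarrow> \<bar>h x - h y\<bar> \<le> c" for x y c
    unfolding d_def using H0 that by (intro cSUP_least) auto
  show thesis
  proof
    show "0 \<le> d x y" for x y using le_d[OF H0, of x y] by simp
    show "d x y = d y x" for x y by (simp add: d_def abs_minus_commute)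
    show "d x y \<le> f x y" for x y by (intro d_le) (simp add: \<H>_def)
    show "d x z \<le> d x y + d y z" for x y z
    proof (rule d_le)
      fix h assume "h \<in> \<H>"
      from le_d[OF this, of x y] le_d[OF this, of y z] show "\<bar>h x - h z\<bar> \<le> d x y + d y z" by linarith
    qed
    fix x y
    \<comment> \<open>The costs of the chains from x to z, and the cost of the cheapest one.\<close>
    define P where "P z = {\<Sum>i=0..<k. f (u i) (u (Suc i)) | u k. u 0 = x \<and> u k = z}" for z
    define h where "h z = Inf (P z)" for z
    have Pne: "P z \<noteq> {}" for z
      unfolding P_def by (auto intro!: exI[of _ "\<lambda>i::nat. if i = 0 then x else z"] exI[of _ "1::nat"])
    have P0: "0 \<le> s" if "s \<in> P z" for s z
      using that nonneg by (auto simp: P_def intro!: sum_nonneg)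
    have h_le: "h z \<le> s" if "s \<in> P z" for s z
      unfolding h_def using that by (rule cInf_lower) (auto intro!: bdd_belowI P0)
    have step: "h z' - f z z' \<le> h z" for z z'
      unfolding h_def[of z]
    proof (rule cInf_greatest[OF Pne])
      fix s assume "s \<in> P z"
      then obtain u k where u: "s = (\<Sum>i=0..<k. f (u i) (u (Suc i)))" "u 0 = x" "u k = z"
        by (auto simp: P_def)
      define v where "v = u(Suc k := z')"
      have "(\<Sum>i=0..<Suc k. f (v i) (v (Suc i))) = s + f z z'"
        using u by (simp add: v_def)
      moreover have "v 0 = x" "v (Suc k) = z'" using u by (auto simp: v_def)
      ultimately have "s + f z z' \<in> P z'" unfolding P_def by (metis (mono_tags, lifting) mem_Collect_eq)
      then show "h z' - f z z' \<le> s" using h_le by fastforce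
    qed
    have "h \<in> \<H>" unfolding \<H>_def using step sym by (auto simp: abs_le_iff) (smt (verit))+
    then have "h y - h x \<le> d x y" using le_d[of h x y] by linarith
    moreover have "0 \<in> P x" unfolding P_def by (auto intro!: exI[of _ "\<lambda>i::nat. x"] exI[of _ "0::nat"])
    then have "h x \<le> 0" using h_le by blast
    moreover have "f x y / 2 \<le> h y"
      unfolding h_def
    proof (rule cInf_greatest[OF Pne])
      fix s assume "s \<in> P y"
      then obtain u k where u: "s = (\<Sum>i=0..<k. f (u i) (u (Suc i)))" "u 0 = x" "u k = y"
        by (auto simp: P_def)
      have "f (u 0) (u k) \<le> 2 * (\<Sum>i=0..<k. f (u i) (u (Suc i)))"
        using nonneg refl three by (intro chain_sum_lower_bound) auto
      then show "f x y / 2 \<le> s" using u by simp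
    qed
    ultimately show "f x y \<le> 2 * d x y" by linarith
  qed
qed

text \<open>
  The pseudometrization of a countable base of entourages: \<open>f x y = 2\<^sup>-\<^sup>n\<close> for the first \<open>n\<close> at which
  \<open>x\<close> and \<open>y\<close> are not related satisfies the three-step inequality, because a failure of \<open>R n\<close>
  between the ends of a chain of three steps is a failure of \<open>R (Suc n)\<close> in one of the steps.
\<close>

lemma pseudometric_of_normal_sequence:
  fixes R :: "nat \<Rightarrow> 'a \<Rightarrow> 'a \<Rightarrow> bool"
  assumes refl: "\<And>n x. R n x x" and sym: "\<And>n x y. R n x y \<Longrightarrow> R n y x"
    and three: "\<And>n x y z w. R (Suc n) x y \<Longrightarrow> R (Suc n) y z \<Longrightarrow> R (Suc n) z w \<Longrightarrow> R n x w"
  obtains d :: "'a \<Rightarrow> 'a \<Rightarrow> real" where "\<And>x y. 0 \<le> d x y" "\<And>x y. d x y = d y x"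
    "\<And>x y z. d x z \<le> d x y + d y z"
    "\<And>n x y. R n x y \<Longrightarrow> d x y < (1/2) ^ n" "\<And>n x y. d x y < (1/2) ^ Suc n \<Longrightarrow> R n x y"
proof -
  have dec: "R m x y" if "R n x y" "m \<le> n" for m n x y
    using that(2,1) by (induction rule: inc_induct) (blast intro: three refl)+
  define l where "l x y = (LEAST n. \<not> R n x y)" for x y
  define f :: "'a \<Rightarrow> 'a \<Rightarrow> real" where "f x y = (if \<forall>n. R n x y then 0 else (1/2) ^ l x y)" for x y
  have l: "\<not> R (l x y) x y" if "\<not> R n x y" for n x y
    unfolding l_def using that by (rule LeastI)
  have small: "f x y < (1/2) ^ n" if "R n x y" for n x y
  proof (cases "\<forall>n. R n x y")
    case False
    then have "n < l x y" using l dec that by (metis not_less)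
    then show ?thesis using False by (simp add: f_def power_strict_decreasing)
  qed (simp add: f_def)
  have large: "(1/2) ^ n \<le> f x y" if "\<not> R n x y" for n x y
  proof -
    have "l x y \<le> n" unfolding l_def using that by (rule Least_le)
    then show ?thesis using that by (auto simp: f_def intro: power_decreasing)
  qed
  have Rsym: "R n x y \<longleftrightarrow> R n y x" for n x y using sym by blast
  obtain d where d: "\<And>x y. 0 \<le> d x y" "\<And>x y. d x y = d y x" "\<And>x y z. d x z \<le> d x y + d y z"
    "\<And>x y. d x y \<le> f x y" "\<And>x y. f x y \<le> 2 * d x y"
  proof (rule pseudometric_between[of f])
    show "0 \<le> f x y" for x y by (simp add: f_def)
    show "f x x = 0" for x using refl by (simp add: f_def)
    show "f x y = f y x" for x y using Rsym[of _ x y] by (simp add: f_def l_def)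
    fix s x y z w assume s: "f x y \<le> s" "f y z \<le> s" "f z w \<le> s"
    show "f x w \<le> 2 * s"
    proof (cases "\<forall>n. R n x w")
      case True
      have "0 \<le> f x y" by (simp add: f_def)
      then show ?thesis using True s by (simp add: f_def)
    next
      case False
      then have fxw: "f x w = (1/2) ^ l x w" by (simp add: f_def)
      have "\<not> R (l x w) x w" using False l by blast
      then have "\<not> R (Suc (l x w)) x y \<or> \<not> R (Suc (l x w)) y z \<or> \<not> R (Suc (l x w)) z w"
        using three by blast
      then have "(1/2) ^ Suc (l x w) \<le> s" using large s by (meson order_trans)
      then show ?thesis by (simp add: fxw)
    qed
  qed blast
  show thesis
  proof (rule that[of d])
    show "d x y < (1/2) ^ n" if "R n x y" for n x y using small[OF that] d(4)[of x y] by linarith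
    show "R n x y" if "d x y < (1/2) ^ Suc n" for n x y
      using large[of n x y] d(5)[of x y] that by fastforce
  qed (rule d)+
qed

text \<open>
  The index set splits into infinitely many infinite parts, and the Scheepers property, applied to
  each part separately, captures every finite set once in each part.
\<close>

lemma Scheepers_infinitely_often:
  fixes \<U> :: "nat \<Rightarrow> 'a set set"
  assumes Z: "Scheepers_space Z" and \<U>: "\<And>n. open_cover Z (\<U> n)"
  obtains \<V> where "\<And>n. finite (\<V> n)" "\<And>n. \<V> n \<subseteq> \<U> n"
    "\<And>K. finite K \<Longrightarrow> K \<subseteq> topspace Z \<Longrightarrow> infinite {n. K \<subseteq> \<Union>(\<V> n)}"
proof -
  have "\<exists>\<V>. (\<forall>l. finite (\<V> l) \<and> \<V> l \<subseteq> \<U> (prod_encode (m, l))) \<and>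
      omega_cover (topspace Z) (range (\<lambda>l. \<Union>(\<V> l)))" for m
    using Z[unfolded Scheepers_space_def, THEN spec[of _ "\<lambda>l. \<U> (prod_encode (m, l))"]] \<U> by blast
  then obtain V where V: "\<And>m l. finite (V m l) \<and> V m l \<subseteq> \<U> (prod_encode (m, l))"
    and omega: "\<And>m. omega_cover (topspace Z) (range (\<lambda>l. \<Union>(V m l)))" by metis
  define \<V> where "\<V> n = (case prod_decode n of (m, l) \<Rightarrow> V m l)" for n
  have \<V>: "\<V> (prod_encode (m, l)) = V m l" for m l by (simp add: \<V>_def)
  show thesis
  proof
    fix n
    obtain m l where "n = prod_encode (m, l)" by (metis prod_decode_inverse surj_pair)
    then show "finite (\<V> n)" "\<V> n \<subseteq> \<U> n" using V \<V> by auto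
  next
    fix K assume "finite K" "K \<subseteq> topspace Z"
    then have "\<exists>l. K \<subseteq> \<Union>(V m l)" for m using omega[of m] by (auto simp: omega_cover_def)
    then obtain l where l: "\<And>m. K \<subseteq> \<Union>(V m (l m))" by metis
    have "inj (\<lambda>m. prod_encode (m, l m))" by (auto simp: inj_def)
    then have "infinite (range (\<lambda>m. prod_encode (m, l m)))" by (rule range_inj_infinite)
    moreover have "range (\<lambda>m. prod_encode (m, l m)) \<subseteq> {n. K \<subseteq> \<Union>(\<V> n)}" using l by (simp add: \<V> image_subset_iff)
    ultimately show "infinite {n. K \<subseteq> \<Union>(\<V> n)}" by (rule infinite_super[rotated])
  qed
qed

text \<open>
  Choosing one point in each class of points at distance zero gives a metric space carried by the
  type of \<open>X\<close>, and the choice map is continuous since it preserves distances.  The Scheepers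
  property of this image is used for its covers by balls.
\<close>

lemma Scheepers_images_pseudometric:
  fixes X :: "'x topology" and d :: "'x \<Rightarrow> 'x \<Rightarrow> real" and \<epsilon> :: "nat \<Rightarrow> real"
  assumes Sch: "\<And>Z :: 'x topology. continuous_metrizable_image X Z \<Longrightarrow> Scheepers_space Z"
    and d: "\<And>x y. 0 \<le> d x y" "\<And>x y. d x y = d y x" "\<And>x y z. d x z \<le> d x y + d y z" "\<And>x. d x x = 0"
    and cont: "\<And>x e. x \<in> topspace X \<Longrightarrow> 0 < e \<Longrightarrow> \<exists>U. openin X U \<and> x \<in> U \<and> (\<forall>y\<in>U. d x y < e)"
    and \<epsilon>: "\<And>n. 0 < \<epsilon> n"
  obtains C where "\<And>n. finite (C n)" "\<And>n. C n \<subseteq> topspace X"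
    "\<And>K. finite K \<Longrightarrow> K \<subseteq> topspace X \<Longrightarrow> infinite {n. \<forall>x\<in>K. \<exists>c\<in>C n. d c x < \<epsilon> n}"
proof -
  define r where "r x = (SOME y. y \<in> topspace X \<and> d x y = 0)" for x
  have r: "r x \<in> topspace X" "d x (r x) = 0" if "x \<in> topspace X" for x
    using someI[of "\<lambda>y. y \<in> topspace X \<and> d x y = 0" x] that d(4) by (auto simp: r_def)
  have d_eq: "d x z = d y z" if "d x y = 0" for x y z
    using d(3)[of x z y] d(3)[of y z x] d(2)[of x y] that by simp
  have r_eq: "r x = r y" if "d x y = 0" for x y unfolding r_def using d_eq[OF that] by simp
  have dr: "d (r x) (r y) = d x y" if "x \<in> topspace X" "y \<in> topspace X" for x y
    using r that d_eq d(2) by metis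
  define M where "M = r ` topspace X"
  have MX: "M \<subseteq> topspace X" using r by (auto simp: M_def)
  interpret Metric_space M d
  proof
    show "d x y = 0 \<longleftrightarrow> x = y" if "x \<in> M" "y \<in> M" for x y
      using that dr r_eq d(4) by (fastforce simp: M_def)
  qed (rule d)+
  have "continuous_map X mtopology r"
    unfolding continuous_map_to_metric
  proof (intro ballI allI impI)
    fix x and e :: real assume x: "x \<in> topspace X" and "0 < e"
    then obtain U where U: "openin X U" "x \<in> U" "\<forall>y\<in>U. d x y < e" using cont by blast
    then have "r y \<in> mball (r x) e" if "y \<in> U" for y
    proof -
      have y: "y \<in> topspace X" using that openin_subset[OF U(1)] by blast
      then have "r x \<in> M" "r y \<in> M" using x by (auto simp: M_def)
      then show ?thesis using that U(3) dr[OF x y] by simp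
    qed
    then show "\<exists>U. openin X U \<and> x \<in> U \<and> (\<forall>y\<in>U. r y \<in> mball (r x) e)" using U by blast
  qed
  then have "continuous_metrizable_image X mtopology"
    unfolding continuous_metrizable_image_def
    using metrizable_space_mtopology by (intro conjI exI[of _ r]) (simp_all flip: M_def)
  then have Sch': "Scheepers_space mtopology" by (rule Sch)
  have "open_cover mtopology ((\<lambda>z. mball z (\<epsilon> n)) ` M)" for n
    using \<epsilon>[of n] by (auto simp: open_cover_def)
  from Scheepers_infinitely_often[where \<U> = "\<lambda>n. (\<lambda>z. mball z (\<epsilon> n)) ` M", OF Sch' this]
  obtain \<V> where
    \<V>: "\<And>n. finite (\<V> n)" "\<And>n. \<V> n \<subseteq> (\<lambda>z. mball z (\<epsilon> n)) ` M"
      "\<And>K. finite K \<Longrightarrow> K \<subseteq> M \<Longrightarrow> infinite {n. K \<subseteq> \<Union>(\<V> n)}"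
    unfolding topspace_mtopology by blast
  have "\<exists>C \<subseteq> M. finite C \<and> \<V> n = (\<lambda>z. mball z (\<epsilon> n)) ` C" for n
    using finite_subset_image[OF \<V>(1,2)] by blast
  then obtain C where C: "\<And>n. C n \<subseteq> M" "\<And>n. finite (C n)"
    "\<And>n. \<V> n = (\<lambda>z. mball z (\<epsilon> n)) ` C n" by metis
  show thesis
  proof
    show "finite (C n)" "C n \<subseteq> topspace X" for n using C(1,2) MX by blast+
    fix K assume K: "finite K" "K \<subseteq> topspace X"
    have "infinite {n. r ` K \<subseteq> \<Union>(\<V> n)}" using K by (intro \<V>(3)) (auto simp: M_def)
    moreover have "{n. r ` K \<subseteq> \<Union>(\<V> n)} \<subseteq> {n. \<forall>x\<in>K. \<exists>c\<in>C n. d c x < \<epsilon> n}"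
    proof (clarify)
      fix n x assume n: "r ` K \<subseteq> \<Union>(\<V> n)" and x: "x \<in> K"
      then obtain c where c: "c \<in> C n" "d c (r x) < \<epsilon> n" by (fastforce simp: C(3))
      moreover have "d c (r x) = d c x" using d_eq[OF r(2), of x c] x K d(2) by auto
      ultimately show "\<exists>c\<in>C n. d c x < \<epsilon> n" by auto
    qed
    ultimately show "infinite {n. \<forall>x\<in>K. \<exists>c\<in>C n. d c x < \<epsilon> n}" by (rule infinite_super[rotated])
  qed
qed


section \<open>Topological groups and Scheepers-bounded sets\<close>

context topological_group
begin

lemma openin_subset_carrier: "openin T U \<Longrightarrow> U \<subseteq> carrier G"
  using openin_subset topspace_eq_carrier by metis

lemma continuous_map_group_mult:
  assumes "continuous_map Z T f" "continuous_map Z T h"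
  shows "continuous_map Z T (\<lambda>z. f z \<otimes> h z)"
proof -
  have "continuous_map Z T ((\<lambda>(x, y). x \<otimes> y) \<circ> (\<lambda>z. (f z, h z)))"
    by (intro continuous_map_compose[OF _ continuous_mult] continuous_map_pairedI assms)
  then show ?thesis by (simp add: o_def)
qed

lemma continuous_map_group_inv:
  "continuous_map Z T f \<Longrightarrow> continuous_map Z T (\<lambda>z. inv (f z))"
  using continuous_map_compose[OF _ continuous_inv] by (simp add: o_def)

lemma open_square_root:
  assumes "openin T U" "\<one> \<in> U"
  shows "\<exists>V. openin T V \<and> \<one> \<in> V \<and> (\<forall>x\<in>V. \<forall>y\<in>V. x \<otimes> y \<in> U)"
proof -
  define W where "W = {z \<in> topspace (prod_topology T T). (\<lambda>(x, y). x \<otimes> y) z \<in> U}"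
  have "openin (prod_topology T T) W"
    unfolding W_def using continuous_mult assms(1) by (rule openin_continuous_map_preimage)
  moreover have "(\<one>, \<one>) \<in> W" using assms(2) by (simp add: W_def topspace_eq_carrier)
  ultimately obtain A B where AB: "openin T A" "openin T B" "\<one> \<in> A" "\<one> \<in> B" "A \<times> B \<subseteq> W"
    by (metis openin_prod_topology_alt)
  then have "openin T (A \<inter> B)" "\<one> \<in> A \<inter> B" by auto
  moreover have "x \<otimes> y \<in> U" if "x \<in> A \<inter> B" "y \<in> A \<inter> B" for x y
    using that AB(5) by (auto simp: W_def)
  ultimately show ?thesis by blast
qed

lemma open_symmetric_cube_root:
  assumes "openin T U" "\<one> \<in> U"
  shows "\<exists>V. openin T V \<and> \<one> \<in> V \<and> (\<forall>x\<in>V. inv x \<in> V) \<and>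
    (\<forall>x\<in>V. \<forall>y\<in>V. \<forall>z\<in>V. x \<otimes> y \<otimes> z \<in> U)"
proof -
  obtain A where A: "openin T A" "\<one> \<in> A" "\<forall>x\<in>A. \<forall>y\<in>A. x \<otimes> y \<in> U"
    using open_square_root[OF assms] by blast
  obtain B where B: "openin T B" "\<one> \<in> B" "\<forall>x\<in>B. \<forall>y\<in>B. x \<otimes> y \<in> A"
    using open_square_root[OF A(1,2)] by blast
  define V where "V = {x \<in> A \<inter> B. inv x \<in> A \<inter> B}"
  have AB: "openin T (A \<inter> B)" using A B by blast
  have "openin T {x \<in> topspace T. inv x \<in> A \<inter> B}"
    using continuous_inv AB by (rule openin_continuous_map_preimage)
  then have "openin T ((A \<inter> B) \<inter> {x \<in> topspace T. inv x \<in> A \<inter> B})"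
    by (rule openin_Int[OF AB])
  moreover have "(A \<inter> B) \<inter> {x \<in> topspace T. inv x \<in> A \<inter> B} = V"
    using openin_subset[OF A(1)] by (auto simp: V_def)
  ultimately have "openin T V" by simp
  moreover have "\<one> \<in> V" using A B by (simp add: V_def)
  moreover have "\<forall>x\<in>V. inv x \<in> V"
    using openin_subset_carrier[OF A(1)] by (auto simp: V_def)
  moreover have "\<forall>x\<in>V. \<forall>y\<in>V. \<forall>z\<in>V. x \<otimes> y \<otimes> z \<in> U"
  proof (intro ballI)
    fix x y z assume "x \<in> V" "y \<in> V" "z \<in> V"
    then have "x \<in> B" "y \<in> B" "z \<in> A" by (simp_all add: V_def)
    then have "x \<otimes> y \<in> A" using B(3) by blast
    then show "x \<otimes> y \<otimes> z \<in> U" using A(3) \<open>z \<in> A\<close> by blast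
  qed
  ultimately show ?thesis by blast
qed

lemma open_finitely_many_conjugates:
  assumes "finite Q" "Q \<subseteq> carrier G" "openin T U" "\<one> \<in> U"
  shows "\<exists>V. openin T V \<and> \<one> \<in> V \<and> (\<forall>q\<in>Q. \<forall>v\<in>V. q \<otimes> v \<otimes> inv q \<in> U)"
  using assms(1,2)
proof induction
  case empty
  show ?case using assms(3,4) by auto
next
  case (insert q Q)
  then obtain V where V: "openin T V" "\<one> \<in> V" "\<forall>q\<in>Q. \<forall>v\<in>V. q \<otimes> v \<otimes> inv q \<in> U" by auto
  have q: "q \<in> carrier G" using insert by simp
  have "continuous_map T T (\<lambda>v. q \<otimes> v \<otimes> inv q)"
    using q by (intro continuous_map_group_mult continuous_map_id[unfolded id_def])
      (auto simp: topspace_eq_carrier)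
  then have "openin T {v \<in> topspace T. q \<otimes> v \<otimes> inv q \<in> U}"
    using assms(3) by (rule openin_continuous_map_preimage)
  then have "openin T (V \<inter> {v \<in> topspace T. q \<otimes> v \<otimes> inv q \<in> U})" using V(1) by blast
  moreover have "\<one> \<in> V \<inter> {v \<in> topspace T. q \<otimes> v \<otimes> inv q \<in> U}"
    using V(2) q assms(4) by (simp add: topspace_eq_carrier)
  ultimately show ?case using V(3) by blast
qed

end

text \<open>
  The Scheepers property of the subset \<open>Y\<close> for its covers by translates \<open>V n <#> {e}\<close> of neighborhoods of
  the identity; the finite subfamilies are given by their centers \<open>E n\<close>.  Every finite set has to be
  captured infinitely often, so that the index sets belonging to finite sets lie in a common free
  filter.
\<close>

definition Scheepers_bounded :: "('g, 'm) monoid_scheme \<Rightarrow> 'g topology \<Rightarrow> 'g set \<Rightarrow> bool"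
  where "Scheepers_bounded G T Y \<longleftrightarrow>
    (\<forall>V :: nat \<Rightarrow> 'g set. (\<forall>n. openin T (V n) \<and> \<one>\<^bsub>G\<^esub> \<in> V n) \<longrightarrow>
      (\<exists>E :: nat \<Rightarrow> 'g set. (\<forall>n. finite (E n) \<and> E n \<subseteq> Y) \<and>
        (\<forall>K. finite K \<and> K \<subseteq> Y \<longrightarrow> infinite {n. K \<subseteq> V n <#>\<^bsub>G\<^esub> E n})))"

text \<open>
  After shrinking, the neighborhoods satisfy \<open>W\<^sub>n\<^sub>+\<^sub>1\<^sup>3 \<subseteq> W\<^sub>n\<close>, and the relations
  \<open>\<phi>\<^sub>i(x) \<phi>\<^sub>i(y)\<inverse> \<in> W\<^sub>n\<close> for all \<open>i\<close> form a normal sequence on \<open>X\<close>.  A single continuous pseudometric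
  handles all \<open>n\<close> and all maps at once; the finite sets provided by its balls are mapped to the group.
\<close>

lemma Scheepers_bounded_union_of_images:
  fixes X :: "'x topology" and \<phi> :: "'i \<Rightarrow> 'x \<Rightarrow> 'g"
  assumes "topological_group G T" and I: "finite I"
    and \<phi>: "\<And>i. i \<in> I \<Longrightarrow> continuous_map X T (\<phi> i)"
    and Sch: "\<And>Z :: 'x topology. continuous_metrizable_image X Z \<Longrightarrow> Scheepers_space Z"
  shows "Scheepers_bounded G T (\<Union>i\<in>I. \<phi> i ` topspace X)"
  unfolding Scheepers_bounded_def
proof (intro allI impI)
  interpret topological_group G T by fact
  have cancel: "inv\<^bsub>G\<^esub> a \<otimes>\<^bsub>G\<^esub> (a \<otimes>\<^bsub>G\<^esub> b) = b" if "a \<in> carrier G" "b \<in> carrier G" for a b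
    using that m_assoc[of "inv\<^bsub>G\<^esub> a" a b] by simp
  fix V :: "nat \<Rightarrow> 'g set"
  assume V: "\<forall>n. openin T (V n) \<and> \<one>\<^bsub>G\<^esub> \<in> V n"
  define P where "P n W \<longleftrightarrow> openin T W \<and> \<one>\<^bsub>G\<^esub> \<in> W \<and> W \<subseteq> V n \<and> (\<forall>x\<in>W. inv\<^bsub>G\<^esub> x \<in> W)" for n W
  have refine: "\<exists>W'. P n W' \<and> (\<forall>x\<in>W'. \<forall>y\<in>W'. \<forall>z\<in>W'. x \<otimes>\<^bsub>G\<^esub> y \<otimes>\<^bsub>G\<^esub> z \<in> W)"
    if W: "openin T W" "\<one>\<^bsub>G\<^esub> \<in> W" for n W
  proof -
    have "openin T (W \<inter> V n)" "\<one>\<^bsub>G\<^esub> \<in> W \<inter> V n" using W V by auto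
    from open_symmetric_cube_root[OF this] obtain W' where W': "openin T W'" "\<one>\<^bsub>G\<^esub> \<in> W'"
      "\<forall>x\<in>W'. inv\<^bsub>G\<^esub> x \<in> W'" "\<forall>x\<in>W'. \<forall>y\<in>W'. \<forall>z\<in>W'. x \<otimes>\<^bsub>G\<^esub> y \<otimes>\<^bsub>G\<^esub> z \<in> W \<inter> V n"
      by blast
    have "x \<in> V n" if "x \<in> W'" for x
    proof -
      have "x \<otimes>\<^bsub>G\<^esub> \<one>\<^bsub>G\<^esub> \<otimes>\<^bsub>G\<^esub> \<one>\<^bsub>G\<^esub> \<in> V n" using W'(2,4) that by blast
      then show ?thesis using that openin_subset_carrier[OF W'(1)] by auto
    qed
    then show ?thesis using W' unfolding P_def by (intro exI[of _ W']) blast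
  qed
  have "\<exists>W. \<forall>n. P n (W n) \<and> (\<forall>x\<in>W (Suc n). \<forall>y\<in>W (Suc n). \<forall>z\<in>W (Suc n). x \<otimes>\<^bsub>G\<^esub> y \<otimes>\<^bsub>G\<^esub> z \<in> W n)"
  proof (rule dependent_nat_choice)
    show "\<exists>W. P 0 W" using refine[of "V 0" 0] V by blast
    show "\<exists>W'. P (Suc n) W' \<and> (\<forall>x\<in>W'. \<forall>y\<in>W'. \<forall>z\<in>W'. x \<otimes>\<^bsub>G\<^esub> y \<otimes>\<^bsub>G\<^esub> z \<in> W)" if "P n W" for n W
      using refine[of W "Suc n"] that by (simp add: P_def)
  qed
  then obtain W where W': "\<And>n. P n (W n)"
    "\<And>n. \<forall>x\<in>W (Suc n). \<forall>y\<in>W (Suc n). \<forall>z\<in>W (Suc n). x \<otimes>\<^bsub>G\<^esub> y \<otimes>\<^bsub>G\<^esub> z \<in> W n"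
    by blast
  have W: "\<And>n. openin T (W n)" "\<And>n. \<one>\<^bsub>G\<^esub> \<in> W n" "\<And>n. W n \<subseteq> V n"
    "\<And>n x. x \<in> W n \<Longrightarrow> inv\<^bsub>G\<^esub> x \<in> W n"
    "\<And>n x y z. x \<in> W (Suc n) \<Longrightarrow> y \<in> W (Suc n) \<Longrightarrow> z \<in> W (Suc n) \<Longrightarrow> x \<otimes>\<^bsub>G\<^esub> y \<otimes>\<^bsub>G\<^esub> z \<in> W n"
    using W' by (simp_all add: P_def)
  \<comment> \<open>The relations below are defined on the whole type, so the maps are given a value in the group everywhere.\<close>
  define \<psi> where "\<psi> i x = (if x \<in> topspace X then \<phi> i x else \<one>\<^bsub>G\<^esub>)" for i x
  have \<psi>: "\<psi> i x \<in> carrier G" if "i \<in> I" for i x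
    using continuous_map_image_subset_topspace[OF \<phi>[OF that]] by (auto simp: \<psi>_def topspace_eq_carrier)
  define R where "R n x y \<longleftrightarrow> (\<forall>i\<in>I. \<psi> i x \<otimes>\<^bsub>G\<^esub> inv\<^bsub>G\<^esub> (\<psi> i y) \<in> W n)" for n x y
  obtain d :: "'x \<Rightarrow> 'x \<Rightarrow> real" where d: "\<And>x y. 0 \<le> d x y" "\<And>x y. d x y = d y x"
    "\<And>x y z. d x z \<le> d x y + d y z"
    and dR: "\<And>n x y. R n x y \<Longrightarrow> d x y < (1/2) ^ n" "\<And>n x y. d x y < (1/2) ^ Suc n \<Longrightarrow> R n x y"
  proof (rule pseudometric_of_normal_sequence[of R])
    show "R n x x" for n x using W(2) \<psi> by (simp add: R_def)
    show "R n y x" if "R n x y" for n x y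
      unfolding R_def
    proof
      fix i assume i: "i \<in> I"
      then have "inv\<^bsub>G\<^esub> (\<psi> i x \<otimes>\<^bsub>G\<^esub> inv\<^bsub>G\<^esub> (\<psi> i y)) \<in> W n" using that W(4) by (auto simp: R_def)
      then show "\<psi> i y \<otimes>\<^bsub>G\<^esub> inv\<^bsub>G\<^esub> (\<psi> i x) \<in> W n" using \<psi>[OF i] by (simp add: inv_mult_group)
    qed
    show "R n x w" if "R (Suc n) x y" "R (Suc n) y z" "R (Suc n) z w" for n x y z w
      unfolding R_def
    proof
      fix i assume i: "i \<in> I"
      then have "(\<psi> i x \<otimes>\<^bsub>G\<^esub> inv\<^bsub>G\<^esub> (\<psi> i y)) \<otimes>\<^bsub>G\<^esub> (\<psi> i y \<otimes>\<^bsub>G\<^esub> inv\<^bsub>G\<^esub> (\<psi> i z))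
          \<otimes>\<^bsub>G\<^esub> (\<psi> i z \<otimes>\<^bsub>G\<^esub> inv\<^bsub>G\<^esub> (\<psi> i w)) \<in> W n"
        using that by (intro W(5)) (auto simp: R_def)
      then show "\<psi> i x \<otimes>\<^bsub>G\<^esub> inv\<^bsub>G\<^esub> (\<psi> i w) \<in> W n"
        using \<psi>[OF i] cancel by (simp add: m_assoc)
    qed
  qed blast
  have d0: "d x x = 0" for x
  proof (rule ccontr)
    assume "d x x \<noteq> 0"
    then have "0 < d x x" using d(1)[of x x] by linarith
    then obtain n where "(1/2) ^ n < d x x" using real_arch_pow_inv[of "d x x" "1/2"] by auto
    moreover have "R n x x" using W(2) \<psi> by (simp add: R_def)
    ultimately show False using dR(1) by fastforce
  qed
  have cont: "\<exists>U. openin X U \<and> x \<in> U \<and> (\<forall>y\<in>U. d x y < e)" if x: "x \<in> topspace X" "0 < e" for x e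
  proof -
    obtain n where n: "(1/2) ^ n < e" using real_arch_pow_inv[of e "1/2"] x(2) by auto
    define U where "U = (\<Inter>i\<in>I. {y \<in> topspace X. \<phi> i x \<otimes>\<^bsub>G\<^esub> inv\<^bsub>G\<^esub> (\<phi> i y) \<in> W n}) \<inter> topspace X"
    have mem: "\<phi> i x \<in> carrier G" if "i \<in> I" for i using \<psi>[OF that, of x] x by (simp add: \<psi>_def)
    have "openin X {y \<in> topspace X. \<phi> i x \<otimes>\<^bsub>G\<^esub> inv\<^bsub>G\<^esub> (\<phi> i y) \<in> W n}" if "i \<in> I" for i
      using mem[OF that] \<phi>[OF that] W(1)
      by (intro openin_continuous_map_preimage[of _ T] continuous_map_group_mult continuous_map_group_inv)
        (auto simp: topspace_eq_carrier)
    then have "openin X U" unfolding U_def using I by (rule openin_INT[rotated])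
    moreover have "x \<in> U" using x mem W(2) by (simp add: U_def)
    moreover have "d x y < e" if "y \<in> U" for y
    proof -
      have "R n x y" using that x by (auto simp: U_def R_def \<psi>_def)
      then show ?thesis using dR(1) n by fastforce
    qed
    ultimately show ?thesis by blast
  qed
  obtain C where C: "\<And>n. finite (C n)" "\<And>n. C n \<subseteq> topspace X"
    "\<And>K. finite K \<Longrightarrow> K \<subseteq> topspace X \<Longrightarrow> infinite {n. \<forall>x\<in>K. \<exists>c\<in>C n. d c x < (1/2) ^ Suc n}"
    by (rule Scheepers_images_pseudometric[of X d "\<lambda>n. (1/2) ^ Suc n", OF Sch d d0 cont])
      (assumption | simp | blast)+
  define E where "E n = (\<Union>i\<in>I. \<phi> i ` C n)" for n
  show "\<exists>E. (\<forall>n. finite (E n) \<and> E n \<subseteq> (\<Union>i\<in>I. \<phi> i ` topspace X)) \<and>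
      (\<forall>K. finite K \<and> K \<subseteq> (\<Union>i\<in>I. \<phi> i ` topspace X) \<longrightarrow> infinite {n. K \<subseteq> V n <#>\<^bsub>G\<^esub> E n})"
  proof (intro exI[of _ E] conjI allI impI)
    show "finite (E n)" for n using C(1) I by (simp add: E_def)
    show "E n \<subseteq> (\<Union>i\<in>I. \<phi> i ` topspace X)" for n using C(2) by (auto simp: E_def)
    fix K assume K: "finite K \<and> K \<subseteq> (\<Union>i\<in>I. \<phi> i ` topspace X)"
    then have "\<forall>y\<in>K. \<exists>i x. i \<in> I \<and> x \<in> topspace X \<and> y = \<phi> i x" by blast
    then obtain ix xx where ix: "\<And>y. y \<in> K \<Longrightarrow> ix y \<in> I \<and> xx y \<in> topspace X \<and> y = \<phi> (ix y) (xx y)"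
      by metis
    have "infinite {n. \<forall>x\<in>xx ` K. \<exists>c\<in>C n. d c x < (1/2) ^ Suc n}"
      using K ix by (intro C(3)) auto
    moreover have "{n. \<forall>x\<in>xx ` K. \<exists>c\<in>C n. d c x < (1/2) ^ Suc n} \<subseteq> {n. K \<subseteq> V n <#>\<^bsub>G\<^esub> E n}"
    proof clarify
      fix n y assume n: "\<forall>x\<in>xx ` K. \<exists>c\<in>C n. d c x < (1/2) ^ Suc n" and y: "y \<in> K"
      then obtain c where c: "c \<in> C n" "d c (xx y) < (1/2) ^ Suc n" by blast
      have ct: "c \<in> topspace X" using c(1) C(2) by blast
      have "R n (xx y) c" using c(2) d(2) dR(2) by metis
      then have "\<psi> (ix y) (xx y) \<otimes>\<^bsub>G\<^esub> inv\<^bsub>G\<^esub> (\<psi> (ix y) c) \<in> W n" using ix[OF y] by (simp add: R_def)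
      moreover have "\<psi> (ix y) (xx y) = y" "\<psi> (ix y) c = \<phi> (ix y) c"
        using ix[OF y] ct by (simp_all add: \<psi>_def)
      moreover have "y \<in> carrier G" "\<phi> (ix y) c \<in> carrier G"
        using \<psi>[of "ix y"] ix[OF y] calculation by metis+
      ultimately have "y \<otimes>\<^bsub>G\<^esub> inv\<^bsub>G\<^esub> (\<phi> (ix y) c) \<in> V n"
        "y = y \<otimes>\<^bsub>G\<^esub> inv\<^bsub>G\<^esub> (\<phi> (ix y) c) \<otimes>\<^bsub>G\<^esub> \<phi> (ix y) c"
        using W(3) by (auto simp: m_assoc)
      moreover have "\<phi> (ix y) c \<in> E n" using c(1) ix[OF y] by (auto simp: E_def)
      ultimately show "y \<in> V n <#>\<^bsub>G\<^esub> E n" unfolding set_mult_def by blast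
    qed
    ultimately show "infinite {n. K \<subseteq> V n <#>\<^bsub>G\<^esub> E n}" by (rule infinite_super[rotated])
  qed
qed


section \<open>Products of generators\<close>

lemma Scheepers_bounded_countable_cover:
  fixes G :: "('g, 'm) monoid_scheme"
  assumes "Scheepers_bounded G T Y" "Y \<subseteq> carrier G" "group G" "openin T V" "\<one>\<^bsub>G\<^esub> \<in> V"
  obtains c :: "nat \<Rightarrow> 'g" where "range c \<subseteq> carrier G" "Y \<subseteq> V <#>\<^bsub>G\<^esub> range c"
proof -
  interpret group G by fact
  have "\<exists>E :: nat \<Rightarrow> 'g set. (\<forall>n. finite (E n) \<and> E n \<subseteq> Y) \<and>
      (\<forall>K. finite K \<and> K \<subseteq> Y \<longrightarrow> infinite {n. K \<subseteq> V <#>\<^bsub>G\<^esub> E n})"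
    using assms(1)[unfolded Scheepers_bounded_def, THEN spec[of _ "\<lambda>_. V"]] assms(4,5) by simp
  then obtain E :: "nat \<Rightarrow> 'g set" where E: "\<And>n. finite (E n)" "\<And>n. E n \<subseteq> Y"
    "\<And>K. finite K \<Longrightarrow> K \<subseteq> Y \<Longrightarrow> infinite {n. K \<subseteq> V <#>\<^bsub>G\<^esub> E n}"
    by metis
  define D where "D = insert \<one>\<^bsub>G\<^esub> (\<Union>n. E n)"
  have "countable D" using E(1) by (simp add: D_def countable_finite)
  then have c: "range (from_nat_into D) = D" by (intro range_from_nat_into) (simp add: D_def)
  show thesis
  proof
    show "range (from_nat_into D) \<subseteq> carrier G" unfolding c using E(2) assms(2) by (auto simp: D_def)
    show "Y \<subseteq> V <#>\<^bsub>G\<^esub> range (from_nat_into D)"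
    proof
      fix y assume "y \<in> Y"
      then have "infinite {n. {y} \<subseteq> V <#>\<^bsub>G\<^esub> E n}" by (intro E(3)) auto
      then obtain n where "y \<in> V <#>\<^bsub>G\<^esub> E n" using not_finite_existsD by auto
      moreover have "E n \<subseteq> D" by (auto simp: D_def)
      ultimately show "y \<in> V <#>\<^bsub>G\<^esub> range (from_nat_into D)"
        unfolding c set_mult_def by blast
    qed
  qed
qed

text \<open>
  For lists \<open>a m 0, a m 1, \<dots>\<close> of group elements, the \<open>n\<close>-th set consists of products of elements with
  \<open>m < n\<close> and position \<open>l \<le> n\<close>, with strong enough closure that a product formed at stage \<open>n\<close> may be
  extended by \<open>a n l\<close> at every later stage \<open>n' \<ge> l\<close>.  It is finite and depends on the lists with
  index below \<open>n\<close> only, which allows the lists to be chosen by recursion.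
\<close>

primrec prefix_products :: "('g, 'm) monoid_scheme \<Rightarrow> (nat \<Rightarrow> nat \<Rightarrow> 'g) \<Rightarrow> nat \<Rightarrow> 'g set" where
  "prefix_products G a 0 = {\<one>\<^bsub>G\<^esub>}"
| "prefix_products G a (Suc n) = prefix_products G a n \<union>
     (\<lambda>(q, m, l). q \<otimes>\<^bsub>G\<^esub> a m l) ` (prefix_products G a n \<times> {..n} \<times> {..Suc n})"

lemma prefix_products_cong:
  "(\<And>m. m < n \<Longrightarrow> a m = b m) \<Longrightarrow> prefix_products G a n = prefix_products G b n"
proof (induction n)
  case (Suc n)
  then have "prefix_products G a n = prefix_products G b n" by simp
  moreover have "(\<lambda>(q, m, l). q \<otimes>\<^bsub>G\<^esub> a m l) ` (S \<times> {..n} \<times> {..Suc n}) =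
      (\<lambda>(q, m, l). q \<otimes>\<^bsub>G\<^esub> b m l) ` (S \<times> {..n} \<times> {..Suc n})" for S
    using Suc.prems by (intro image_cong) auto
  ultimately show ?case by simp
qed simp

lemma finite_prefix_products: "finite (prefix_products G a n)"
  by (induction n) auto

lemma one_in_prefix_products: "\<one>\<^bsub>G\<^esub> \<in> prefix_products G a n"
  by (induction n) auto

lemma (in group) prefix_products_closed:
  "(\<And>m l. m < n \<Longrightarrow> a m l \<in> carrier G) \<Longrightarrow> prefix_products G a n \<subseteq> carrier G"
proof (induction n)
  case (Suc n)
  then have "prefix_products G a n \<subseteq> carrier G" by simp
  then show ?case using Suc.prems by auto
qed simp

lemma prefix_products_mono: "n \<le> n' \<Longrightarrow> prefix_products G a n \<subseteq> prefix_products G a n'"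
  by (induction n' rule: dec_induct) auto

lemma prefix_products_extend:
  assumes "q \<in> prefix_products G a n" "n < n'" "l \<le> n'"
  shows "q \<otimes>\<^bsub>G\<^esub> a n l \<in> prefix_products G a n'"
proof -
  obtain k where k: "n' = Suc k" "n \<le> k" using assms(2) by (metis less_Suc_eq_le less_imp_Suc_add)
  from subsetD[OF prefix_products_mono[OF k(2)] assms(1)]
  have "q \<in> prefix_products G a k" .
  then have "(q, n, l) \<in> prefix_products G a k \<times> {..k} \<times> {..Suc k}" using k assms(3) by simp
  from imageI[OF this, of "\<lambda>(q, m, l). q \<otimes>\<^bsub>G\<^esub> a m l"] show ?thesis unfolding k(1) by simp
qed

lemma (in group) foldr_mult_closed:
  "set ys \<subseteq> carrier G \<Longrightarrow> foldr (\<otimes>) ys \<one> \<in> carrier G"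
  by (induction ys) auto

lemma (in group) foldr_mult_append:
  "set us \<subseteq> carrier G \<Longrightarrow> set vs \<subseteq> carrier G \<Longrightarrow>
    foldr (\<otimes>) (us @ vs) \<one> = foldr (\<otimes>) us \<one> \<otimes> foldr (\<otimes>) vs \<one>"
proof (induction us)
  case (Cons u us)
  then show ?case using foldr_mult_closed[of us] foldr_mult_closed[of vs]
    by (simp add: m_assoc del: foldr_append)
qed (simp add: foldr_mult_closed)

lemma (in group) generate_words:
  assumes Z: "Z \<subseteq> carrier G" and "g \<in> generate G Z"
  shows "\<exists>ys. set ys \<subseteq> Z \<union> m_inv G ` Z \<and> g = foldr (\<otimes>) ys \<one>"
  using assms(2)
proof induction
  case one
  show ?case by (intro exI[of _ "[]"]) simp
next
  case (incl h)
  then show ?case using Z by (intro exI[of _ "[h]"]) auto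
next
  case (inv h)
  then show ?case using Z by (intro exI[of _ "[inv h]"]) auto
next
  case (eng g h)
  then obtain us vs where us: "set us \<subseteq> Z \<union> m_inv G ` Z" "g = foldr (\<otimes>) us \<one>"
    and vs: "set vs \<subseteq> Z \<union> m_inv G ` Z" "h = foldr (\<otimes>) vs \<one>" by blast
  have "Z \<union> m_inv G ` Z \<subseteq> carrier G" using Z by auto
  then have "g \<otimes> h = foldr (\<otimes>) (us @ vs) \<one>"
    using us vs foldr_mult_append[of us vs] by (metis subset_trans)
  then show ?case using us(1) vs(1) by (intro exI[of _ "us @ vs"]) simp
qed

text \<open>
  A word \<open>y\<^sub>1 \<cdots> y\<^sub>k\<close> is rewritten from the left, with the product \<open>q\<close> of the elements already split
  off as a prefix.  Splitting the next letter as \<open>y = u a\<close>, with \<open>u\<close> in the square of \<open>V n\<close>, moves the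
  factor \<open>q u q\<inverse>\<close> to the front, where it lies in \<open>M (Suc n)\<close>, and replaces \<open>q\<close> by \<open>q a\<close>.  The
  condition \<open>g n \<le> n'\<close> on consecutive indices keeps the new prefix among those for which the
  next neighborhood was chosen.  The factors at the front multiply within \<open>M N\<close> because the indices
  increase and \<open>M (Suc n)\<close> has its square in \<open>M n\<close>.
\<close>

lemma (in group) conjugation_telescope:
  fixes a :: "nat \<Rightarrow> nat \<Rightarrow> 'a" and g :: "nat \<Rightarrow> nat" and M V :: "nat \<Rightarrow> 'a set"
  assumes a: "\<And>m l. a m l \<in> carrier G"
    and M: "\<And>n. M n \<subseteq> carrier G" "\<And>n. \<one> \<in> M n"
      "\<And>n x y. x \<in> M (Suc n) \<Longrightarrow> y \<in> M (Suc n) \<Longrightarrow> x \<otimes> y \<in> M n"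
    and V: "\<And>n. V n \<subseteq> carrier G"
      "\<And>n q v w. q \<in> prefix_products G a n \<Longrightarrow> v \<in> V n \<Longrightarrow> w \<in> V n \<Longrightarrow>
        q \<otimes> (v \<otimes> w) \<otimes> inv q \<in> M (Suc n)"
    and "length ns = length ys" "sorted_wrt (\<lambda>n n'. n < n' \<and> g n \<le> n') ns"
    and "\<And>n y. n \<in> set ns \<Longrightarrow> y \<in> set ys \<Longrightarrow> \<exists>v\<in>V n. \<exists>w\<in>V n. \<exists>l\<le>g n. y = (v \<otimes> w) \<otimes> a n l"
    and "set ys \<subseteq> carrier G" "\<And>n. n \<in> set ns \<Longrightarrow> N \<le> n \<and> q \<in> prefix_products G a n" "q \<in> carrier G"
  shows "\<exists>as. \<exists>m\<in>M N. set as \<subseteq> {a n l | n l. n \<in> set ns \<and> l \<le> g n} \<and> length as = length ys \<and>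
      q \<otimes> foldr (\<otimes>) ys \<one> = m \<otimes> (q \<otimes> foldr (\<otimes>) as \<one>)"
  using assms(7-)
proof (induction ys arbitrary: ns N q)
  case Nil
  then show ?case using M(2)[of N] by (intro exI[of _ "[]"] bexI[of _ \<one>]) auto
next
  case (Cons y ys)
  have M_dec: "M n' \<subseteq> M n" if "n \<le> n'" for n n'
    using that
  proof (induction rule: dec_induct)
    case (step n')
    have "x \<in> M n'" if "x \<in> M (Suc n')" for x
      using M(3)[OF that M(2)] M(1)[of "Suc n'"] that by auto
    then show ?case using step by blast
  qed simp
  obtain n ns' where ns: "ns = n # ns'" using Cons.prems(1) by (cases ns) auto
  obtain v w l where vw: "v \<in> V n" "w \<in> V n" "l \<le> g n" "y = (v \<otimes> w) \<otimes> a n l"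
    using Cons.prems(3)[of n y] ns by auto
  have q: "N \<le> n" "q \<in> prefix_products G a n" "q \<in> carrier G" using Cons.prems(5,6) ns by auto
  have vwc: "v \<otimes> w \<in> carrier G" using vw V(1)[of n] by auto
  define q' where "q' = q \<otimes> a n l"
  have qc: "q' \<in> carrier G" using q(3) a by (simp add: q'_def)
  have later: "Suc n \<le> n' \<and> q' \<in> prefix_products G a n'" if "n' \<in> set ns'" for n'
  proof -
    have "n < n'" "g n \<le> n'" using Cons.prems(2) ns that by auto
    then show ?thesis unfolding q'_def using q(2) vw(3) by (auto intro: prefix_products_extend)
  qed
  have "\<exists>as. \<exists>m\<in>M (Suc n). set as \<subseteq> {a n l | n l. n \<in> set ns' \<and> l \<le> g n} \<and> length as = length ys \<and>
      q' \<otimes> foldr (\<otimes>) ys \<one> = m \<otimes> (q' \<otimes> foldr (\<otimes>) as \<one>)"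
  proof (rule Cons.IH)
    show "\<exists>v\<in>V n'. \<exists>w\<in>V n'. \<exists>l\<le>g n'. y' = (v \<otimes> w) \<otimes> a n' l" if "n' \<in> set ns'" "y' \<in> set ys" for n' y'
      using Cons.prems(3)[of n' y'] that ns by simp
    show "length ns' = length ys" using Cons.prems(1) ns by simp
    show "sorted_wrt (\<lambda>n n'. n < n' \<and> g n \<le> n') ns'" using Cons.prems(2) ns by simp
    show "set ys \<subseteq> carrier G" using Cons.prems(4) by simp
    show "q' \<in> carrier G" by (rule qc)
    show "Suc n \<le> n' \<and> q' \<in> prefix_products G a n'" if "n' \<in> set ns'" for n'
      using that by (rule later)
  qed
  then obtain as m where as: "m \<in> M (Suc n)" "set as \<subseteq> {a n l | n l. n \<in> set ns' \<and> l \<le> g n}"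
    "length as = length ys" "q' \<otimes> foldr (\<otimes>) ys \<one> = m \<otimes> (q' \<otimes> foldr (\<otimes>) as \<one>)" by blast
  define c where "c = q \<otimes> (v \<otimes> w) \<otimes> inv q"
  have c: "c \<in> M (Suc n)" unfolding c_def using V(2) q(2) vw(1,2) by blast
  have mem: "c \<in> carrier G" "m \<in> carrier G" "a n l \<in> carrier G" using c as(1) M(1) a by blast+
  have ysc: "foldr (\<otimes>) ys \<one> \<in> carrier G" using Cons.prems(4) by (intro foldr_mult_closed) simp
  have asc: "foldr (\<otimes>) as \<one> \<in> carrier G" using as(2) a by (intro foldr_mult_closed) auto
  have "q \<otimes> y = c \<otimes> q'"
  proof -
    have "inv q \<otimes> (q \<otimes> a n l) = a n l" using q(3) mem(3) m_assoc[of "inv q" q "a n l"] by simp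
    then show ?thesis unfolding c_def q'_def vw(4) using q(3) vwc mem(3) by (simp add: m_assoc)
  qed
  then have "q \<otimes> (y \<otimes> foldr (\<otimes>) ys \<one>) = c \<otimes> (q' \<otimes> foldr (\<otimes>) ys \<one>)"
    using m_assoc[OF q(3) _ ysc, of y] m_assoc[OF mem(1) qc ysc] Cons.prems(4) by simp
  also have "\<dots> = (c \<otimes> m) \<otimes> (q' \<otimes> foldr (\<otimes>) as \<one>)"
    using as(4) mem qc asc by (simp add: m_assoc)
  also have "q' \<otimes> foldr (\<otimes>) as \<one> = q \<otimes> foldr (\<otimes>) (a n l # as) \<one>"
    using q(3) mem(3) asc by (simp add: q'_def m_assoc)
  finally have "q \<otimes> foldr (\<otimes>) (y # ys) \<one> = (c \<otimes> m) \<otimes> (q \<otimes> foldr (\<otimes>) (a n l # as) \<one>)" by simp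
  moreover have "c \<otimes> m \<in> M N" using M(3)[OF c as(1)] M_dec[OF q(1)] by blast
  moreover have "set (a n l # as) \<subseteq> {a n l | n l. n \<in> set ns \<and> l \<le> g n}"
  proof -
    have "a n l \<in> {a n l | n l. n \<in> set ns \<and> l \<le> g n}" using vw(3) ns by auto
    moreover have "{a n l | n l. n \<in> set ns' \<and> l \<le> g n} \<subseteq> {a n l | n l. n \<in> set ns \<and> l \<le> g n}"
      using ns by auto
    ultimately show ?thesis using as(2) by simp
  qed
  moreover have "length (a n l # as) = length (y # ys)" using as(3) by simp
  ultimately show ?case
    by (intro exI[of _ "a n l # as"] bexI[of _ "c \<otimes> m"] conjI)
qed


section \<open>Scheepers-bounded generators give o-bounded groups\<close>

text \<open>
  The neighborhoods and lists of the telescope are chosen by recursion, the bound \<open>g\<close> comes from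
  the finite sets of Scheepers-boundedness, and \<open>S y\<close> is the set of indices at which the generator
  \<open>y\<close> is approximated by one of the first elements, up to position \<open>g n\<close>, of the \<open>n\<close>-th list.
  Their finite intersections are infinite, so the absence of Q-points supplies finite blocks
  of indices in which every word finds enough indices for its letters.
\<close>

lemma Scheepers_bounded_imp_o_bounded:
  fixes G :: "('g, 'm) monoid_scheme"
  assumes noQ: "\<not> (\<exists>U. Q_point U)" and "topological_group G T"
    and Y: "Scheepers_bounded G T Y" "Y \<subseteq> carrier G"
    and gen: "\<And>z. z \<in> carrier G \<Longrightarrow> \<exists>ys. set ys \<subseteq> Y \<and> z = foldr (\<otimes>\<^bsub>G\<^esub>) ys \<one>\<^bsub>G\<^esub>"
  shows "o_bounded G T"
  unfolding o_bounded_def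
proof (intro allI impI)
  interpret topological_group G T by fact
  fix U :: "nat \<Rightarrow> 'g set"
  assume U: "\<forall>n. neighborhood_of_one G T (U n)"
  define P where "P n V \<longleftrightarrow> openin T V \<and> \<one>\<^bsub>G\<^esub> \<in> V \<and> V \<subseteq> U n" for n V
  have refine: "\<exists>V'. P n V' \<and> (\<forall>x\<in>V'. \<forall>y\<in>V'. x \<otimes>\<^bsub>G\<^esub> y \<in> V)"
    if V: "openin T V" "\<one>\<^bsub>G\<^esub> \<in> V" for n V
  proof -
    obtain A where A: "openin T A" "\<one>\<^bsub>G\<^esub> \<in> A" "A \<subseteq> U n"
      using U unfolding neighborhood_of_one_def by blast
    obtain B where B: "openin T B" "\<one>\<^bsub>G\<^esub> \<in> B" "\<forall>x\<in>B. \<forall>y\<in>B. x \<otimes>\<^bsub>G\<^esub> y \<in> V"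
      using open_square_root[OF V] by blast
    show ?thesis unfolding P_def
      by (rule exI[of _ "A \<inter> B"]) (use A B in auto)
  qed
  \<comment> \<open>The neighborhoods to which the telescope contracts: each one contains the square of the next.\<close>
  have "\<exists>M. \<forall>n. P n (M n) \<and> (\<forall>x\<in>M (Suc n). \<forall>y\<in>M (Suc n). x \<otimes>\<^bsub>G\<^esub> y \<in> M n)"
  proof (rule dependent_nat_choice)
    show "\<exists>V. P 0 V" using U unfolding neighborhood_of_one_def P_def by blast
    show "\<exists>V'. P (Suc n) V' \<and> (\<forall>x\<in>V'. \<forall>y\<in>V'. x \<otimes>\<^bsub>G\<^esub> y \<in> V)" if "P n V" for n V
      using refine[of V "Suc n"] that by (simp add: P_def)
  qed
  then obtain M where M': "\<And>n. P n (M n)"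
    "\<And>n. \<forall>x\<in>M (Suc n). \<forall>y\<in>M (Suc n). x \<otimes>\<^bsub>G\<^esub> y \<in> M n" by blast
  have M: "\<And>n. openin T (M n)" "\<And>n. \<one>\<^bsub>G\<^esub> \<in> M n" "\<And>n. M n \<subseteq> U n"
    "\<And>n x y. x \<in> M (Suc n) \<Longrightarrow> y \<in> M (Suc n) \<Longrightarrow> x \<otimes>\<^bsub>G\<^esub> y \<in> M n"
    using M' by (simp_all add: P_def)

  \<comment> \<open>At stage n, a neighborhood whose square is small under conjugation by the earlier products, and a list whose translates cover Y.\<close>
  define admissible where "admissible s n r \<longleftrightarrow>
      openin T (fst r) \<and> \<one>\<^bsub>G\<^esub> \<in> fst r \<and> range (snd r) \<subseteq> carrier G \<and>
      Y \<subseteq> fst r <#>\<^bsub>G\<^esub> range (snd r) \<and>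
      (\<forall>q\<in>prefix_products G (\<lambda>m. snd (s m)) n. \<forall>v\<in>fst r. \<forall>w\<in>fst r.
         q \<otimes>\<^bsub>G\<^esub> (v \<otimes>\<^bsub>G\<^esub> w) \<otimes>\<^bsub>G\<^esub> inv\<^bsub>G\<^esub> q \<in> M (Suc n))"
    for s :: "nat \<Rightarrow> 'g set \<times> (nat \<Rightarrow> 'g)" and n :: nat and r :: "'g set \<times> (nat \<Rightarrow> 'g)"
  have "\<exists>s. \<forall>n. admissible s n (s n)"
  proof (rule dependent_wellorder_choice)
    fix r :: "'g set \<times> (nat \<Rightarrow> 'g)" and f g :: "nat \<Rightarrow> 'g set \<times> (nat \<Rightarrow> 'g)" and n :: nat
    assume "\<And>m. m < n \<Longrightarrow> f m = g m"
    then have "prefix_products G (\<lambda>m. snd (f m)) n = prefix_products G (\<lambda>m. snd (g m)) n"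
      by (intro prefix_products_cong) simp
    then show "admissible f n r = admissible g n r" by (simp add: admissible_def)
  next
    fix n :: nat and f :: "nat \<Rightarrow> 'g set \<times> (nat \<Rightarrow> 'g)"
    assume IH: "\<And>m. m < n \<Longrightarrow> admissible f m (f m)"
    define Q where "Q = prefix_products G (\<lambda>m. snd (f m)) n"
    have "range (snd (f m)) \<subseteq> carrier G" if "m < n" for m
      using IH[OF that] by (simp add: admissible_def)
    then have "Q \<subseteq> carrier G" unfolding Q_def by (intro prefix_products_closed) blast
    moreover have "finite Q" unfolding Q_def by (rule finite_prefix_products)
    ultimately obtain W where W: "openin T W" "\<one>\<^bsub>G\<^esub> \<in> W"
      "\<forall>q\<in>Q. \<forall>v\<in>W. q \<otimes>\<^bsub>G\<^esub> v \<otimes>\<^bsub>G\<^esub> inv\<^bsub>G\<^esub> q \<in> M (Suc n)"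
      using open_finitely_many_conjugates[of Q "M (Suc n)"] M(1,2) by blast
    obtain V where V: "openin T V" "\<one>\<^bsub>G\<^esub> \<in> V" "\<forall>x\<in>V. \<forall>y\<in>V. x \<otimes>\<^bsub>G\<^esub> y \<in> W"
      using open_square_root[OF W(1,2)] by blast
    obtain c :: "nat \<Rightarrow> 'g" where c: "range c \<subseteq> carrier G" "Y \<subseteq> V <#>\<^bsub>G\<^esub> range c"
      using Scheepers_bounded_countable_cover[OF Y is_group V(1,2)] by blast
    have "admissible f n (V, c)"
      unfolding admissible_def using V W(3) c by (simp flip: Q_def)
    then show "\<exists>r. admissible f n r" ..
  qed
  then obtain s where s: "\<And>n. admissible s n (s n)" by blast
  define V where "V n = fst (s n)" for n
  define a where "a n = snd (s n)" for n
  have V: "openin T (V n)" "\<one>\<^bsub>G\<^esub> \<in> V n" "Y \<subseteq> V n <#>\<^bsub>G\<^esub> range (a n)" for n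
    using s[of n] by (simp_all add: admissible_def V_def a_def)
  have aG: "a n l \<in> carrier G" for n l
  proof -
    have "range (a n) \<subseteq> carrier G" using s[of n] by (simp add: admissible_def a_def)
    then show ?thesis by blast
  qed
  have conj: "q \<otimes>\<^bsub>G\<^esub> (v \<otimes>\<^bsub>G\<^esub> w) \<otimes>\<^bsub>G\<^esub> inv\<^bsub>G\<^esub> q \<in> M (Suc n)"
    if "q \<in> prefix_products G a n" "v \<in> V n" "w \<in> V n" for q v w n
  proof -
    have "a = (\<lambda>m. snd (s m))" by (rule ext) (simp add: a_def)
    then show ?thesis using s[of n] that by (simp add: admissible_def V_def)
  qed

  have "\<exists>E :: nat \<Rightarrow> 'g set. (\<forall>n. finite (E n) \<and> E n \<subseteq> Y) \<and>
      (\<forall>K. finite K \<and> K \<subseteq> Y \<longrightarrow> infinite {n. K \<subseteq> V n <#>\<^bsub>G\<^esub> E n})"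
    using Y(1)[unfolded Scheepers_bounded_def, THEN spec[of _ V]] V by simp
  then obtain E :: "nat \<Rightarrow> 'g set" where E: "\<And>n. finite (E n)" "\<And>n. E n \<subseteq> Y"
    "\<And>K. finite K \<Longrightarrow> K \<subseteq> Y \<Longrightarrow> infinite {n. K \<subseteq> V n <#>\<^bsub>G\<^esub> E n}"
    by metis
  define idx where "idx n e = (SOME l. \<exists>w\<in>V n. e = w \<otimes>\<^bsub>G\<^esub> a n l)" for n e
  have idx: "\<exists>w\<in>V n. e = w \<otimes>\<^bsub>G\<^esub> a n (idx n e)" if "e \<in> E n" for n e
    unfolding idx_def
  proof -
    have "e \<in> V n <#>\<^bsub>G\<^esub> range (a n)" using that E(2) V(3) by blast
    then have "\<exists>l. \<exists>w\<in>V n. e = w \<otimes>\<^bsub>G\<^esub> a n l" unfolding set_mult_def by blast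
    then show "\<exists>w\<in>V n. e = w \<otimes>\<^bsub>G\<^esub> a n (SOME l. \<exists>w\<in>V n. e = w \<otimes>\<^bsub>G\<^esub> a n l)"
      by (rule someI_ex)
  qed
  define g where "g n = Max (insert 0 (idx n ` E n))" for n
  have g: "idx n e \<le> g n" if "e \<in> E n" for n e
    unfolding g_def using that E(1) by (intro Max_ge) auto
  define S where "S y = {n. \<exists>v\<in>V n. \<exists>w\<in>V n. \<exists>l\<le>g n. y = (v \<otimes>\<^bsub>G\<^esub> w) \<otimes>\<^bsub>G\<^esub> a n l}" for y
  have S: "infinite (\<Inter>K)" if K: "finite K" "K \<subseteq> S ` Y" for K
  proof -
    obtain L where L: "L \<subseteq> Y" "finite L" "K = S ` L" using finite_subset_image[OF K] by blast
    have "{n. L \<subseteq> V n <#>\<^bsub>G\<^esub> E n} \<subseteq> \<Inter>K"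
    proof
      fix n assume "n \<in> {n. L \<subseteq> V n <#>\<^bsub>G\<^esub> E n}"
      then have n: "L \<subseteq> V n <#>\<^bsub>G\<^esub> E n" by simp
      have "n \<in> S y" if y: "y \<in> L" for y
      proof -
        obtain v e where ve: "v \<in> V n" "e \<in> E n" "y = v \<otimes>\<^bsub>G\<^esub> e"
          using n y unfolding set_mult_def by blast
        obtain w where w: "w \<in> V n" "e = w \<otimes>\<^bsub>G\<^esub> a n (idx n e)" using idx[OF ve(2)] by blast
        have "v \<in> carrier G" "w \<in> carrier G"
          using ve(1) w(1) openin_subset_carrier[OF V(1)] by blast+
        then have "y = (v \<otimes>\<^bsub>G\<^esub> w) \<otimes>\<^bsub>G\<^esub> a n (idx n e)" using ve(3) w(2) aG m_assoc by metis
        then show ?thesis unfolding S_def using ve(1) w(1) g[OF ve(2)] by blast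
      qed
      then show "n \<in> \<Inter>K" by (simp add: L(3))
    qed
    moreover have "infinite {n. L \<subseteq> V n <#>\<^bsub>G\<^esub> E n}" using E(3) L by blast
    ultimately show ?thesis by (rule infinite_super)
  qed
  obtain p :: "nat \<Rightarrow> nat" where p: "\<And>n. p n \<le> n" "\<And>b. finite (p -` {b})"
    "\<And>K k. finite K \<Longrightarrow> K \<subseteq> S ` Y \<Longrightarrow> \<exists>b ns. length ns = k \<and> set ns \<subseteq> \<Inter>K \<inter> p -` {b} \<and>
       sorted_wrt (\<lambda>n n'. n < n' \<and> g n \<le> n') ns"
    by (rule no_Q_point_sparse_blocks[where S = "S ` Y" and g = g, OF noQ S]) (assumption | (rule that; assumption))+
  \<comment> \<open>The words used by block b have distinct indices, so their length is at most the size of the block.\<close>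
  define L where "L b = {as. set as \<subseteq> {a n l | n l. n \<in> p -` {b} \<and> l \<le> g n} \<and> length as \<le> card (p -` {b})}" for b
  define F where "F b = (\<lambda>as. foldr (\<otimes>\<^bsub>G\<^esub>) as \<one>\<^bsub>G\<^esub>) ` L b" for b
  have "finite (F b)" for b
  proof -
    have "{a n l | n l. n \<in> p -` {b} \<and> l \<le> g n} = (\<lambda>(n, l). a n l) ` (SIGMA n:p -` {b}. {..g n})" by auto
    then have "finite {a n l | n l. n \<in> p -` {b} \<and> l \<le> g n}" using p(2) by simp
    then show ?thesis unfolding F_def L_def by (intro finite_imageI finite_lists_length_le)
  qed
  moreover have FG: "F b \<subseteq> carrier G" for b
  proof -
    have "foldr (\<otimes>\<^bsub>G\<^esub>) as \<one>\<^bsub>G\<^esub> \<in> carrier G" if "as \<in> L b" for as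
      using that aG by (intro foldr_mult_closed) (auto simp: L_def)
    then show ?thesis by (auto simp: F_def)
  qed
  moreover have "carrier G = (\<Union>b. U b <#>\<^bsub>G\<^esub> F b)"
  proof
    have "U b \<subseteq> carrier G" for b using U by (simp add: neighborhood_of_one_def topspace_eq_carrier)
    then show "(\<Union>b. U b <#>\<^bsub>G\<^esub> F b) \<subseteq> carrier G" using FG set_mult_closed by blast
    show "carrier G \<subseteq> (\<Union>b. U b <#>\<^bsub>G\<^esub> F b)"
    proof
      fix z assume "z \<in> carrier G"
      then obtain ys where ys: "set ys \<subseteq> Y" "z = foldr (\<otimes>\<^bsub>G\<^esub>) ys \<one>\<^bsub>G\<^esub>" using gen by blast
      obtain b ns where ns: "length ns = length ys" "set ns \<subseteq> \<Inter>(S ` set ys) \<inter> p -` {b}"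
        "sorted_wrt (\<lambda>n n'. n < n' \<and> g n \<le> n') ns"
        using p(3)[of "S ` set ys" "length ys"] ys(1) by blast
      have "\<exists>as. \<exists>m\<in>M b. set as \<subseteq> {a n l | n l. n \<in> set ns \<and> l \<le> g n} \<and> length as = length ys \<and>
          \<one>\<^bsub>G\<^esub> \<otimes>\<^bsub>G\<^esub> foldr (\<otimes>\<^bsub>G\<^esub>) ys \<one>\<^bsub>G\<^esub> = m \<otimes>\<^bsub>G\<^esub> (\<one>\<^bsub>G\<^esub> \<otimes>\<^bsub>G\<^esub> foldr (\<otimes>\<^bsub>G\<^esub>) as \<one>\<^bsub>G\<^esub>)"
      proof (rule conjugation_telescope[of a M V])
        show "\<exists>v\<in>V n. \<exists>w\<in>V n. \<exists>l\<le>g n. y = (v \<otimes>\<^bsub>G\<^esub> w) \<otimes>\<^bsub>G\<^esub> a n l" if "n \<in> set ns" "y \<in> set ys" for n y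
          using ns(2) that by (auto simp: S_def)
        show "b \<le> n \<and> \<one>\<^bsub>G\<^esub> \<in> prefix_products G a n" if "n \<in> set ns" for n
          using ns(2) that p(1)[of n] one_in_prefix_products by auto
        show "set ys \<subseteq> carrier G" using ys(1) Y(2) by blast
        show "M n \<subseteq> carrier G" "V n \<subseteq> carrier G" for n
          using M(1) V(1) openin_subset_carrier by blast+
        show "a n l \<in> carrier G" for n l by (rule aG)
        show "\<one>\<^bsub>G\<^esub> \<in> M n" for n by (rule M(2))
        show "x \<otimes>\<^bsub>G\<^esub> y \<in> M n" if "x \<in> M (Suc n)" "y \<in> M (Suc n)" for n x y
          using that by (rule M(4))
        show "q \<otimes>\<^bsub>G\<^esub> (v \<otimes>\<^bsub>G\<^esub> w) \<otimes>\<^bsub>G\<^esub> inv\<^bsub>G\<^esub> q \<in> M (Suc n)"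
          if "q \<in> prefix_products G a n" "v \<in> V n" "w \<in> V n" for n q v w
          using that by (rule conj)
        show "length ns = length ys" by (rule ns(1))
        show "sorted_wrt (\<lambda>n n'. n < n' \<and> g n \<le> n') ns" by (rule ns(3))
      qed simp
      then obtain as m where as: "m \<in> M b" "set as \<subseteq> {a n l | n l. n \<in> set ns \<and> l \<le> g n}"
        "length as = length ys"
        "\<one>\<^bsub>G\<^esub> \<otimes>\<^bsub>G\<^esub> foldr (\<otimes>\<^bsub>G\<^esub>) ys \<one>\<^bsub>G\<^esub> = m \<otimes>\<^bsub>G\<^esub> (\<one>\<^bsub>G\<^esub> \<otimes>\<^bsub>G\<^esub> foldr (\<otimes>\<^bsub>G\<^esub>) as \<one>\<^bsub>G\<^esub>)" by blast
      have "distinct ns" using ns(3) by (induction ns) auto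
      then have "length ns \<le> card (p -` {b})"
        using ns(2) card_mono[OF p(2), of "set ns" b] by (simp add: distinct_card)
      moreover have "set as \<subseteq> {a n l | n l. n \<in> p -` {b} \<and> l \<le> g n}"
      proof -
        have "{a n l | n l. n \<in> set ns \<and> l \<le> g n} \<subseteq> {a n l | n l. n \<in> p -` {b} \<and> l \<le> g n}"
          using ns(2) by blast
        then show ?thesis using as(2) by (rule subset_trans[rotated])
      qed
      ultimately have "as \<in> L b" using as(3) ns(1) by (simp add: L_def)
      then have "foldr (\<otimes>\<^bsub>G\<^esub>) as \<one>\<^bsub>G\<^esub> \<in> F b" by (auto simp: F_def)
      moreover have "z = m \<otimes>\<^bsub>G\<^esub> foldr (\<otimes>\<^bsub>G\<^esub>) as \<one>\<^bsub>G\<^esub>"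
      proof -
        have "foldr (\<otimes>\<^bsub>G\<^esub>) ys \<one>\<^bsub>G\<^esub> \<in> carrier G" using ys(2) \<open>z \<in> carrier G\<close> by simp
        moreover have "foldr (\<otimes>\<^bsub>G\<^esub>) as \<one>\<^bsub>G\<^esub> \<in> carrier G"
          using FG \<open>foldr (\<otimes>\<^bsub>G\<^esub>) as \<one>\<^bsub>G\<^esub> \<in> F b\<close> by blast
        ultimately show ?thesis using as(4) ys(2) by simp
      qed
      moreover have "m \<in> U b" using as(1) M(3) by blast
      ultimately have "z \<in> U b <#>\<^bsub>G\<^esub> F b" unfolding set_mult_def by blast
      then show "z \<in> (\<Union>b. U b <#>\<^bsub>G\<^esub> F b)" by blast
    qed
  qed
  ultimately show "\<exists>F :: nat \<Rightarrow> 'g set. (\<forall>n. finite (F n) \<and> F n \<subseteq> carrier G) \<and>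
      carrier G = (\<Union>n. U n <#>\<^bsub>G\<^esub> F n)" by blast
qed

text \<open>
  Words in the generators and their inverses are words in a union of twice as many continuous
  images, since inversion is continuous.
\<close>

lemma o_bounded_of_Scheepers_generators:
  fixes X :: "'x topology" and G :: "('g, 'm) monoid_scheme" and \<phi> :: "'i \<Rightarrow> 'x \<Rightarrow> 'g"
  assumes noQ: "\<not> (\<exists>U. Q_point U)" and "topological_group G T" and I: "finite I"
    and \<phi>: "\<And>i. i \<in> I \<Longrightarrow> continuous_map X T (\<phi> i)"
    and gen: "carrier G \<subseteq> generate G (\<Union>i\<in>I. \<phi> i ` topspace X)"
    and Sch: "\<And>Z :: 'x topology. continuous_metrizable_image X Z \<Longrightarrow> Scheepers_space Z"
  shows "o_bounded G T"
proof -
  interpret topological_group G T by fact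
  define Z where "Z = (\<Union>i\<in>I. \<phi> i ` topspace X)"
  have Z: "Z \<subseteq> carrier G"
    using continuous_map_image_subset_topspace[OF \<phi>] unfolding Z_def topspace_eq_carrier by (intro UN_least)
  define \<psi> where "\<psi> = (\<lambda>(i, b) x. if b then \<phi> i x else inv\<^bsub>G\<^esub> (\<phi> i x))"
  have eq: "(\<Union>k\<in>I \<times> UNIV. \<psi> k ` topspace X) = Z \<union> m_inv G ` Z"
  proof -
    have "(\<Union>k\<in>I \<times> UNIV. \<psi> k ` topspace X) =
        (\<Union>i\<in>I. \<psi> (i, True) ` topspace X) \<union> (\<Union>i\<in>I. \<psi> (i, False) ` topspace X)"
      by (simp add: UNIV_bool Sigma_def) blast
    then show ?thesis by (simp add: \<psi>_def Z_def image_UN image_image)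
  qed
  have "continuous_map X T (\<psi> k)" if kI: "k \<in> I \<times> UNIV" for k
  proof -
    obtain i b where k: "k = (i, b)" "i \<in> I" using kI by (cases k) auto
    then show ?thesis
      using \<phi>[OF k(2)] continuous_map_group_inv[OF \<phi>[OF k(2)]] by (cases b) (simp_all add: \<psi>_def)
  qed
  then have "Scheepers_bounded G T (\<Union>k\<in>I \<times> UNIV. \<psi> k ` topspace X)"
    by (intro Scheepers_bounded_union_of_images[OF assms(2)] Sch) (simp_all add: I)
  then have "Scheepers_bounded G T (Z \<union> m_inv G ` Z)" by (simp only: eq)
  then show ?thesis
  proof (rule Scheepers_bounded_imp_o_bounded[OF noQ assms(2)])
    show "Z \<union> m_inv G ` Z \<subseteq> carrier G" using Z by auto
    show "\<exists>ys. set ys \<subseteq> Z \<union> m_inv G ` Z \<and> z = foldr (\<otimes>\<^bsub>G\<^esub>) ys \<one>\<^bsub>G\<^esub>" if "z \<in> carrier G" for z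
    proof -
      have "z \<in> generate G Z" using gen that unfolding Z_def by blast
      then show ?thesis by (rule generate_words[OF Z])
    qed
  qed
qed


section \<open>Generators, homomorphic images and powers\<close>

lemma o_bounded_hom_image:
  fixes G :: "('g, 'm) monoid_scheme" and H :: "('h, 'n) monoid_scheme"
  assumes "topological_group G T" "topological_group H S" and oG: "o_bounded G T"
    and h: "h \<in> hom G H" "continuous_map T S h" "h ` carrier G = carrier H"
  shows "o_bounded H S"
  unfolding o_bounded_def
proof (intro allI impI)
  interpret G: topological_group G T by fact
  interpret H: topological_group H S by fact
  have one: "h \<one>\<^bsub>G\<^esub> = \<one>\<^bsub>H\<^esub>" using h(1) G.is_group H.is_group by (rule hom_one)
  fix U :: "nat \<Rightarrow> 'h set"
  assume U: "\<forall>n. neighborhood_of_one H S (U n)"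
  define U' where "U' n = {x \<in> topspace T. h x \<in> U n}" for n
  have "neighborhood_of_one G T (U' n)" for n
  proof -
    obtain V where V: "openin S V" "\<one>\<^bsub>H\<^esub> \<in> V" "V \<subseteq> U n"
      using U unfolding neighborhood_of_one_def by blast
    have "openin T {x \<in> topspace T. h x \<in> V}" using h(2) V(1) by (rule openin_continuous_map_preimage)
    moreover have "\<one>\<^bsub>G\<^esub> \<in> {x \<in> topspace T. h x \<in> V}" using V(2) one by (simp add: G.topspace_eq_carrier)
    moreover have "{x \<in> topspace T. h x \<in> V} \<subseteq> U' n" "U' n \<subseteq> topspace T" using V(3) by (auto simp: U'_def)
    ultimately show ?thesis unfolding neighborhood_of_one_def by blast
  qed
  then have "\<forall>n. neighborhood_of_one G T (U' n)" by blast
  from oG[unfolded o_bounded_def, THEN spec[of _ U'], THEN mp, OF this]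
  obtain F :: "nat \<Rightarrow> 'g set" where F: "\<forall>n. finite (F n) \<and> F n \<subseteq> carrier G"
    "carrier G = (\<Union>n. U' n <#>\<^bsub>G\<^esub> F n)"
    by (elim exE conjE)
  have UH: "U n \<subseteq> carrier H" for n using U by (simp add: neighborhood_of_one_def H.topspace_eq_carrier)
  have FH: "h ` F n \<subseteq> carrier H" for n using F(1) h(3) by blast
  have "carrier H = (\<Union>n. U n <#>\<^bsub>H\<^esub> h ` F n)"
  proof
    show "(\<Union>n. U n <#>\<^bsub>H\<^esub> h ` F n) \<subseteq> carrier H"
      using H.set_mult_closed[OF UH FH] by blast
    show "carrier H \<subseteq> (\<Union>n. U n <#>\<^bsub>H\<^esub> h ` F n)"
    proof
      fix y assume "y \<in> carrier H"
      then obtain x where x: "x \<in> carrier G" "y = h x" using h(3) by blast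
      then obtain n u f where u: "u \<in> U' n" "f \<in> F n" "x = u \<otimes>\<^bsub>G\<^esub> f"
        using F(2) unfolding set_mult_def by blast
      have "u \<in> carrier G" "f \<in> carrier G" using u F(1) by (auto simp: U'_def G.topspace_eq_carrier)
      then have "y = h u \<otimes>\<^bsub>H\<^esub> h f" using h(1) x(2) u(3) by (simp add: hom_mult)
      moreover have "h u \<in> U n" using u(1) by (simp add: U'_def)
      ultimately show "y \<in> (\<Union>n. U n <#>\<^bsub>H\<^esub> h ` F n)" using u(2) unfolding set_mult_def by blast
    qed
  qed
  then show "\<exists>F :: nat \<Rightarrow> 'h set. (\<forall>n. finite (F n) \<and> F n \<subseteq> carrier H) \<and>
      carrier H = (\<Union>n. U n <#>\<^bsub>H\<^esub> F n)"
    using F(1) FH by (intro exI[of _ "\<lambda>n. h ` F n"]) simp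
qed

lemma (in topological_group) topological_group_subgroup:
  assumes K: "subgroup K G"
  shows "topological_group (G\<lparr>carrier := K\<rparr>) (subtopology T K)"
proof (intro topological_group.intro topological_group_axioms.intro)
  interpret K: subgroup K G by fact
  show "group (G\<lparr>carrier := K\<rparr>)" using is_group by (rule K.subgroup_is_group)
  have top: "topspace (subtopology T K) = K" using K.subset by (auto simp: topspace_eq_carrier)
  then show "topspace (subtopology T K) = carrier (G\<lparr>carrier := K\<rparr>)" by simp
  have "continuous_map (prod_topology (subtopology T K) (subtopology T K)) T (\<lambda>(x, y). x \<otimes> y)"
    unfolding subtopology_Times[symmetric] using continuous_mult by (rule continuous_map_from_subtopology)
  then show "continuous_map (prod_topology (subtopology T K) (subtopology T K)) (subtopology T K)
      (\<lambda>(x, y). x \<otimes>\<^bsub>G\<lparr>carrier := K\<rparr>\<^esub> y)"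
    using top by (auto simp: continuous_map_in_subtopology)
  have "continuous_map (subtopology T K) (subtopology T K) (\<lambda>x. inv x)"
    using top continuous_inv by (auto simp: continuous_map_in_subtopology continuous_map_from_subtopology)
  then show "continuous_map (subtopology T K) (subtopology T K) (\<lambda>x. inv\<^bsub>G\<lparr>carrier := K\<rparr>\<^esub> x)"
    by (rule continuous_map_eq) (simp add: top m_inv_consistent[OF K])
qed

text \<open>
  The embedding of \<open>X\<close> extends to a homomorphism into the subgroup generated by \<open>X\<close>.  Viewed as
  an endomorphism of the whole group it agrees with the identity on \<open>X\<close>, so it is the identity by
  uniqueness of extensions.
\<close>

lemma carrier_eq_generate_of_universal:
  fixes F :: "('f, 'm) monoid_scheme"
  assumes "topological_group F T" and i: "embedding_map X T i"
    and up: "\<And>(H :: ('f, 'm) monoid_scheme) S \<phi>. topological_group H S \<Longrightarrow>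
      (comm_group F \<Longrightarrow> comm_group H) \<Longrightarrow> continuous_map X S \<phi> \<Longrightarrow> \<exists>!\<Phi>. extends_to_hom X F T i H S \<phi> \<Phi>"
  shows "carrier F = generate F (i ` topspace X)"
proof
  interpret topological_group F T by fact
  have iF: "i ` topspace X \<subseteq> carrier F" using embedding_map_into_carrier[OF assms(1,2)] by blast
  define K where "K = generate F (i ` topspace X)"
  have K: "subgroup K F" unfolding K_def using iF by (rule generate_is_subgroup)
  have KF: "K \<subseteq> carrier F" using K by (rule subgroup.subset)
  have iK: "i ` topspace X \<subseteq> K" unfolding K_def by (auto intro: generate.incl)
  show "generate F (i ` topspace X) \<subseteq> carrier F" using KF by (simp add: K_def)
  have ci: "continuous_map X T i" using i unfolding embedding_map_def
    by (meson homeomorphic_imp_continuous_map continuous_map_into_fulltopology)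
  have tK: "topological_group (F\<lparr>carrier := K\<rparr>) (subtopology T K)"
    by (rule topological_group_subgroup[OF K])
  have cK: "comm_group (F\<lparr>carrier := K\<rparr>)" if "comm_group F"
  proof (rule group.group_comm_groupI)
    show "group (F\<lparr>carrier := K\<rparr>)" using tK by (rule topological_group.axioms(1))
    show "x \<otimes>\<^bsub>F\<lparr>carrier := K\<rparr>\<^esub> y = y \<otimes>\<^bsub>F\<lparr>carrier := K\<rparr>\<^esub> x"
      if "x \<in> carrier (F\<lparr>carrier := K\<rparr>)" "y \<in> carrier (F\<lparr>carrier := K\<rparr>)" for x y
      using that KF comm_monoid.m_comm[OF comm_group.axioms(1)[OF \<open>comm_group F\<close>], of x y] by auto
  qed
  have "continuous_map X (subtopology T K) i"
    using ci iK by (auto simp: continuous_map_in_subtopology)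
  then obtain \<Phi> where \<Phi>: "extends_to_hom X F T i (F\<lparr>carrier := K\<rparr>) (subtopology T K) i \<Phi>"
    using up[OF tK cK] by blast
  have "extends_to_hom X F T i F T i \<Phi>"
    using \<Phi> KF by (auto simp: extends_to_hom_def hom_def continuous_map_in_subtopology)
  moreover have "extends_to_hom X F T i F T i (\<lambda>x\<in>carrier F. x)"
  proof -
    have "continuous_map T T (\<lambda>x\<in>carrier F. x)"
      by (rule continuous_map_eq[OF continuous_map_id]) (simp add: topspace_eq_carrier)
    then show ?thesis using iF by (auto simp: extends_to_hom_def hom_def)
  qed
  ultimately have eq: "\<Phi> = (\<lambda>x\<in>carrier F. x)"
    using up[OF assms(1) _ ci] by blast
  show "carrier F \<subseteq> generate F (i ` topspace X)"
  proof
    fix x assume x: "x \<in> carrier F"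
    then have "\<Phi> x \<in> K" using \<Phi> by (auto simp: extends_to_hom_def hom_def)
    then show "x \<in> generate F (i ` topspace X)" using x eq by (simp add: K_def)
  qed
qed

lemma free_topological_group_generated:
  assumes "free_topological_group X F T i"
  shows "carrier F = generate F (i ` topspace X)"
proof (rule carrier_eq_generate_of_universal)
  show "topological_group F T" "embedding_map X T i"
    using assms unfolding free_topological_group_def by blast+
qed (rule free_topological_group_universal[OF assms])

lemma free_abelian_topological_group_generated:
  assumes "free_abelian_topological_group X A T j"
  shows "carrier A = generate A (j ` topspace X)"
proof (rule carrier_eq_generate_of_universal)
  have A: "topological_group A T" "embedding_map X T j" "comm_group A"
    using assms unfolding free_abelian_topological_group_def by blast+
  then show "topological_group A T" "embedding_map X T j" by blast+
  fix H S \<phi>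
  assume "topological_group H S" "comm_group A \<Longrightarrow> comm_group H" "continuous_map X S \<phi>"
  then show "\<exists>!\<Phi>. extends_to_hom X A T j H S \<phi> \<Phi>"
    using A(3) by (intro free_abelian_topological_group_universal[OF assms]) auto
qed

lemma topological_group_product:
  fixes G :: "'i \<Rightarrow> ('g, 'm) monoid_scheme"
  assumes G: "\<And>i. i \<in> I \<Longrightarrow> topological_group (G i) (T i)"
  shows "topological_group (product_group I G) (product_topology T I)"
proof (intro topological_group.intro topological_group_axioms.intro)
  have grp: "group (G i)" if "i \<in> I" for i using G[OF that] by (rule topological_group.axioms(1))
  then show "group (product_group I G)" by simp
  have top: "topspace (product_topology T I) = (\<Pi>\<^sub>E i\<in>I. carrier (G i))"
    unfolding topspace_product_topology using G
    by (intro PiE_cong) (simp add: topological_group.topspace_eq_carrier)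
  then show "topspace (product_topology T I) = carrier (product_group I G)" by simp
  let ?P = "product_topology T I"
  show "continuous_map (prod_topology ?P ?P) ?P (\<lambda>(x, y). x \<otimes>\<^bsub>product_group I G\<^esub> y)"
    unfolding continuous_map_componentwise
  proof (intro conjI ballI)
    fix k assume k: "k \<in> I"
    have "continuous_map (prod_topology ?P ?P) (T k) (\<lambda>z. fst z k)"
      using continuous_map_compose[OF continuous_map_fst continuous_map_product_projection[OF k]]
      by (simp add: o_def)
    moreover have "continuous_map (prod_topology ?P ?P) (T k) (\<lambda>z. snd z k)"
      using continuous_map_compose[OF continuous_map_snd continuous_map_product_projection[OF k]]
      by (simp add: o_def)
    ultimately have "continuous_map (prod_topology ?P ?P) (T k) (\<lambda>z. fst z k \<otimes>\<^bsub>G k\<^esub> snd z k)"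
      by (rule topological_group.continuous_map_group_mult[OF G[OF k]])
    then show "continuous_map (prod_topology ?P ?P) (T k)
        (\<lambda>z. (case z of (x, y) \<Rightarrow> x \<otimes>\<^bsub>product_group I G\<^esub> y) k)"
      using k by (simp add: case_prod_unfold)
  qed (auto simp: case_prod_unfold)
  have "continuous_map ?P ?P (\<lambda>x. \<lambda>k\<in>I. inv\<^bsub>G k\<^esub> x k)"
    unfolding continuous_map_componentwise
  proof (intro conjI ballI)
    fix k assume k: "k \<in> I"
    have "continuous_map ?P (T k) (\<lambda>x. inv\<^bsub>G k\<^esub> x k)"
      by (intro topological_group.continuous_map_group_inv[OF G[OF k]] continuous_map_product_projection k)
    then show "continuous_map ?P (T k) (\<lambda>x. (\<lambda>k\<in>I. inv\<^bsub>G k\<^esub> x k) k)" using k by simp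
  qed auto
  then show "continuous_map ?P ?P (\<lambda>x. inv\<^bsub>product_group I G\<^esub> x)"
    by (rule continuous_map_eq) (simp add: top grp del: topspace_product_topology)
qed

definition coordinate_embedding ::
    "nat \<Rightarrow> ('g, 'm) monoid_scheme \<Rightarrow> nat \<Rightarrow> 'g \<Rightarrow> nat \<Rightarrow> 'g"
  where "coordinate_embedding n G k y = (\<lambda>l\<in>{..<n}. if l = k then y else \<one>\<^bsub>G\<^esub>)"

lemma (in group) generate_power_group:
  assumes Z: "Z \<subseteq> carrier G" and gen: "carrier G = generate G Z"
  shows "carrier (power_group n G) \<subseteq> generate (power_group n G) (\<Union>k<n. coordinate_embedding n G k ` Z)"
proof
  let ?P = "power_group n G"
  let ?c = "coordinate_embedding n G"
  let ?Z = "\<Union>k<n. ?c k ` Z"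
  have grpP: "group ?P" using is_group by simp
  have c_in: "?c k y \<in> generate ?P ?Z" if k: "k < n" and "y \<in> carrier G" for k y
    using \<open>y \<in> carrier G\<close> unfolding gen
  proof induction
    case one
    have "?c k \<one> = \<one>\<^bsub>?P\<^esub>" by (auto simp: coordinate_embedding_def)
    then show ?case using generate.one[of ?P ?Z] by (simp only:)
  next
    case (incl h)
    then show ?case using k by (intro generate.incl) auto
  next
    case (inv h)
    then have h: "h \<in> carrier G" using Z by blast
    then have "inv\<^bsub>?P\<^esub> (?c k h) = ?c k (inv h)"
      by (subst inv_product_group) (auto simp: coordinate_embedding_def)
    moreover have "inv\<^bsub>?P\<^esub> (?c k h) \<in> generate ?P ?Z" using inv k by (intro generate.inv) auto
    ultimately show ?case by simp
  next
    case (eng g h)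
    then have "g \<in> carrier G" "h \<in> carrier G" using gen by auto
    then have "?c k (g \<otimes> h) = ?c k g \<otimes>\<^bsub>?P\<^esub> ?c k h" by (auto simp: coordinate_embedding_def)
    then show ?case using generate.eng[OF eng.IH] by (simp only:)
  qed
  fix z assume z: "z \<in> carrier ?P"
  have "(\<lambda>m\<in>{..<n}. if m < l then z m else \<one>) \<in> generate ?P ?Z" if "l \<le> n" for l
    using that
  proof (induction l)
    case 0
    have "(\<lambda>m\<in>{..<n}. if m < 0 then z m else \<one>) = \<one>\<^bsub>?P\<^esub>" by auto
    then show ?case using generate.one[of ?P ?Z] by (simp only:)
  next
    case (Suc l)
    then have zc: "z m \<in> carrier G" if "m < n" for m using z that by auto
    have "(\<lambda>m\<in>{..<n}. if m < Suc l then z m else \<one>) =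
        (\<lambda>m\<in>{..<n}. if m < l then z m else \<one>) \<otimes>\<^bsub>?P\<^esub> ?c l (z l)"
      using Suc.prems zc by (auto simp: coordinate_embedding_def less_Suc_eq fun_eq_iff)
    moreover have "(\<lambda>m\<in>{..<n}. if m < l then z m else \<one>) \<in> generate ?P ?Z"
      using Suc.prems by (intro Suc.IH) simp
    moreover have "?c l (z l) \<in> generate ?P ?Z" using Suc.prems zc by (intro c_in) auto
    ultimately show ?case using generate.eng by (simp only:)
  qed
  from this[of n] have "(\<lambda>m\<in>{..<n}. if m < n then z m else \<one>) \<in> generate ?P ?Z" by simp
  moreover have "(\<lambda>m\<in>{..<n}. if m < n then z m else \<one>) = z"
    using z by (auto simp: fun_eq_iff PiE_def extensional_def)
  ultimately show "z \<in> generate ?P ?Z" by simp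
qed

text \<open>
  The power is generated by the coordinate copies of the generators, which are finitely many
  continuous images of \<open>X\<close>.
\<close>

lemma o_bounded_powers_of_Scheepers_generated:
  fixes X :: "'x topology" and G :: "('g, 'm) monoid_scheme"
  assumes noQ: "\<not> (\<exists>U. Q_point U)" and "topological_group G T"
    and i: "continuous_map X T i" and gen: "carrier G = generate G (i ` topspace X)"
    and Sch: "\<And>Z :: 'x topology. continuous_metrizable_image X Z \<Longrightarrow> Scheepers_space Z"
  shows "o_bounded (power_group n G) (power_topology n T)"
proof (rule o_bounded_of_Scheepers_generators[OF noQ, where I = "{..<n}" and X = X and
      \<phi> = "\<lambda>k x. coordinate_embedding n G k (i x)"])
  interpret topological_group G T by fact
  show "topological_group (power_group n G) (power_topology n T)"
    by (rule topological_group_product) (rule assms(2))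
  have iG: "i ` topspace X \<subseteq> carrier G"
    using continuous_map_image_subset_topspace[OF i] by (simp add: topspace_eq_carrier)
  show "carrier (power_group n G) \<subseteq>
      generate (power_group n G) (\<Union>k<n. (\<lambda>x. coordinate_embedding n G k (i x)) ` topspace X)"
    using generate_power_group[OF iG gen] by (simp only: image_image)
  show "continuous_map X (power_topology n T) (\<lambda>x. coordinate_embedding n G k (i x))" if "k \<in> {..<n}" for k
    unfolding continuous_map_componentwise
  proof (intro conjI ballI)
    fix l assume l: "l \<in> {..<n}"
    show "continuous_map X T (\<lambda>x. coordinate_embedding n G k (i x) l)"
      using l i by (cases "l = k") (simp_all add: coordinate_embedding_def topspace_eq_carrier)
  qed (auto simp: coordinate_embedding_def)
qed (use Sch in auto)


section \<open>Metrizable images of a space whose free abelian group is o-bounded\<close>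

context Metric_space
begin

text \<open>
  The Lebesgue number, capped at 1, of the family \<open>\<V>\<close> at the single point \<open>x\<close>.  The value \<open>r = 0\<close> is
  admitted so that the supremum exists, and is 0, when no ball around \<open>x\<close> fits into a member of \<open>\<V>\<close>.
\<close>

definition lebesgue_radius :: "'a set set \<Rightarrow> 'a \<Rightarrow> real"
  where "lebesgue_radius \<V> x = Sup {r. 0 \<le> r \<and> r \<le> 1 \<and> (r = 0 \<or> (\<exists>U\<in>\<V>. mball x r \<subseteq> U))}"

lemma lebesgue_radius_upper:
  "0 \<le> r \<Longrightarrow> r \<le> 1 \<Longrightarrow> r = 0 \<or> (\<exists>U\<in>\<V>. mball x r \<subseteq> U) \<Longrightarrow> r \<le> lebesgue_radius \<V> x"
  unfolding lebesgue_radius_def by (intro cSup_upper bdd_aboveI[of _ 1]) auto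

lemma lebesgue_radius_least:
  "(\<And>r. 0 \<le> r \<Longrightarrow> r \<le> 1 \<Longrightarrow> r = 0 \<or> (\<exists>U\<in>\<V>. mball x r \<subseteq> U) \<Longrightarrow> r \<le> c) \<Longrightarrow> lebesgue_radius \<V> x \<le> c"
  unfolding lebesgue_radius_def by (intro cSup_least) (auto intro: exI[of _ 0])

lemma lebesgue_radius_nonneg: "0 \<le> lebesgue_radius \<V> x"
  by (rule lebesgue_radius_upper) auto

lemma lebesgue_radius_mono: "\<V> \<subseteq> \<W> \<Longrightarrow> lebesgue_radius \<V> x \<le> lebesgue_radius \<W> x"
  by (rule lebesgue_radius_least, rule lebesgue_radius_upper) auto

lemma lebesgue_radius_approx:
  assumes "c < lebesgue_radius \<V> x" "0 \<le> c"
  obtains r U where "c < r" "r \<le> 1" "U \<in> \<V>" "mball x r \<subseteq> U"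
proof -
  have "\<exists>r. 0 \<le> r \<and> r \<le> 1 \<and> (r = 0 \<or> (\<exists>U\<in>\<V>. mball x r \<subseteq> U)) \<and> c < r"
  proof (rule ccontr)
    assume none: "\<not> ?thesis"
    have "lebesgue_radius \<V> x \<le> c"
    proof (rule lebesgue_radius_least)
      fix r :: real assume "0 \<le> r" "r \<le> 1" "r = 0 \<or> (\<exists>U\<in>\<V>. mball x r \<subseteq> U)"
      then show "r \<le> c" using none not_less by blast
    qed
    then show False using assms(1) by simp
  qed
  then show thesis using that assms(2) by force
qed

lemma lebesgue_radius_lipschitz:
  assumes "x \<in> M" "y \<in> M"
  shows "\<bar>lebesgue_radius \<V> x - lebesgue_radius \<V> y\<bar> \<le> d x y"
proof -
  have *: "lebesgue_radius \<V> x \<le> lebesgue_radius \<V> y + d x y" if "x \<in> M" "y \<in> M" for x y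
  proof (rule lebesgue_radius_least)
    fix r :: real assume r: "0 \<le> r" "r \<le> 1" "r = 0 \<or> (\<exists>U\<in>\<V>. mball x r \<subseteq> U)"
    show "r \<le> lebesgue_radius \<V> y + d x y"
    proof (cases "r \<le> d x y")
      case True
      then show ?thesis using lebesgue_radius_nonneg[of \<V> y] by linarith
    next
      case False
      then obtain U where U: "U \<in> \<V>" "mball x r \<subseteq> U" using r nonneg[of x y] by force
      have "mball y (r - d x y) \<subseteq> U"
        using mball_subset[of y x "r - d x y" r] that U(2) by (simp add: commute)
      then have "r - d x y \<le> lebesgue_radius \<V> y"
        using False r(2) nonneg[of x y] U(1) by (intro lebesgue_radius_upper) (linarith, linarith, blast)
      then show ?thesis by simp
    qed
  qed
  show ?thesis using *[OF assms] *[OF assms(2,1)] by (simp add: commute abs_le_iff)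
qed

end

text \<open>
  A cover-testing family measures how far a point is from being covered by a subfamily \<open>\<V>\<close> of the
  cover.  Its equicontinuity, uniform in \<open>\<V>\<close>, is what makes the induced map into the bounded functions on the
  set of all \<open>\<V>\<close> continuous.
\<close>

definition cover_testing_family ::
    "'y topology \<Rightarrow> 'y set set \<Rightarrow> ('y set set \<Rightarrow> 'y \<Rightarrow> real) \<Rightarrow> bool"
  where "cover_testing_family Y \<U> h \<longleftrightarrow> (\<forall>\<V> y. 0 \<le> h \<V> y \<and> h \<V> y \<le> 1) \<and>
    (\<forall>y\<in>topspace Y. \<forall>e>0. \<exists>W. openin Y W \<and> y \<in> W \<and> (\<forall>z\<in>W. \<forall>\<V>. \<bar>h \<V> y - h \<V> z\<bar> \<le> e)) \<and>
    (\<forall>y\<in>topspace Y. \<exists>U\<in>\<U>. \<forall>\<V>. U \<in> \<V> \<longrightarrow> h \<V> y = 0) \<and>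
    (\<forall>y\<in>topspace Y. \<forall>\<V>. h \<V> y < 1 \<longrightarrow> y \<in> \<Union>(\<V> \<inter> \<U>))"

text \<open>
  The ratio of the Lebesgue number of \<open>\<V>\<close> to that of the whole cover lies in \<open>[0, 1]\<close> and is at least
  \<open>1 / 2\<close> as soon as \<open>\<V>\<close> contains a member of the cover that is nearly optimal at the point.
  Numerator and denominator are 1-Lipschitz and the denominator is positive, so near a given point
  the ratios for different \<open>\<V>\<close> vary at a common rate.
\<close>

lemma exists_cover_testing_family:
  fixes Y :: "'y topology"
  assumes "metrizable_space Y" and \<U>: "open_cover Y \<U>"
  shows "\<exists>h. cover_testing_family Y \<U> h"
proof -
  obtain M d where "Metric_space M d" and Y: "Y = Metric_space.mtopology M d"
    using assms(1) unfolding metrizable_space_def by blast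
  interpret Metric_space M d by fact
  have top: "topspace Y = M" by (simp add: Y)
  define L where "L = lebesgue_radius"
  define h where "h \<V> y = 1 - min 1 (2 * (L (\<V> \<inter> \<U>) y / L \<U> y))" for \<V> y
  have Lnn: "0 \<le> L \<V> y" for \<V> y by (simp add: L_def lebesgue_radius_nonneg)
  have Lle: "L (\<V> \<inter> \<U>) y \<le> L \<U> y" for \<V> y unfolding L_def by (rule lebesgue_radius_mono) simp
  have lip: "\<bar>L \<V> y - L \<V> z\<bar> \<le> d y z" if "y \<in> M" "z \<in> M" for \<V> y z
    unfolding L_def using that by (rule lebesgue_radius_lipschitz)
  have Lpos: "0 < L \<U> y" if y: "y \<in> M" for y
  proof -
    obtain U where U: "U \<in> \<U>" "y \<in> U" "openin mtopology U"
      using \<U> y top by (auto simp: open_cover_def Y)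
    then obtain r where r: "0 < r" "mball y r \<subseteq> U" using openin_mtopology by blast
    then have "mball y (min r 1) \<subseteq> U" by auto
    then have "min r 1 \<le> L \<U> y"
      unfolding L_def using r(1) U(1) by (intro lebesgue_radius_upper) auto
    then show ?thesis using r(1) by linarith
  qed
  have "cover_testing_family Y \<U> h"
    unfolding cover_testing_family_def
  proof (intro conjI allI ballI impI)
    show "0 \<le> h \<V> y" for \<V> y by (simp add: h_def)
    show "h \<V> y \<le> 1" for \<V> y using Lnn by (simp add: h_def)
    show "y \<in> \<Union>(\<V> \<inter> \<U>)" if y: "y \<in> topspace Y" and h: "h \<V> y < 1" for \<V> y
    proof -
      have "L (\<V> \<inter> \<U>) y \<noteq> 0" using h by (auto simp: h_def)
      then have "0 < L (\<V> \<inter> \<U>) y" using Lnn[of "\<V> \<inter> \<U>" y] by simp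
      then obtain r U where r: "0 < r" "U \<in> \<V> \<inter> \<U>" "mball y r \<subseteq> U"
        unfolding L_def by (rule lebesgue_radius_approx) auto
      then have "y \<in> mball y r" using y top by simp
      then show ?thesis using r by blast
    qed
    show "\<exists>U\<in>\<U>. \<forall>\<V>. U \<in> \<V> \<longrightarrow> h \<V> y = 0" if y: "y \<in> topspace Y" for y
    proof -
      have pos: "0 < L \<U> y" using y top Lpos by simp
      then have "L \<U> y / 2 < lebesgue_radius \<U> y" "0 \<le> L \<U> y / 2" by (simp_all add: L_def)
      then obtain r U where r: "L \<U> y / 2 < r" "r \<le> 1" "U \<in> \<U>" "mball y r \<subseteq> U"
        by (rule lebesgue_radius_approx)
      have "h \<V> y = 0" if "U \<in> \<V>" for \<V>
      proof -
        have "r \<le> L (\<V> \<inter> \<U>) y"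
          unfolding L_def using r pos that by (intro lebesgue_radius_upper) auto
        then have "1 \<le> 2 * (L (\<V> \<inter> \<U>) y / L \<U> y)" using r(1) pos by (simp add: field_simps)
        then show ?thesis by (simp add: h_def)
      qed
      then show ?thesis using r(3) by blast
    qed
    fix y and e :: real assume y: "y \<in> topspace Y" and e: "0 < e"
    define \<rho> where "\<rho> = L \<U> y"
    have yM: "y \<in> M" and \<rho>: "0 < \<rho>" using y top Lpos by (simp_all add: \<rho>_def)
    \<comment> \<open>The first bound keeps the denominator above half of its value at y, the second controls the ratio.\<close>
    define \<delta> where "\<delta> = min (\<rho> / 2) (e * \<rho> / 8)"
    have \<delta>: "0 < \<delta>" "\<delta> \<le> \<rho> / 2" "8 * \<delta> \<le> e * \<rho>" using \<rho> e by (auto simp: \<delta>_def)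
    have "\<bar>h \<V> y - h \<V> z\<bar> \<le> e" if z: "z \<in> mball y \<delta>" for z \<V>
    proof -
      define a b \<sigma> where "a = L (\<V> \<inter> \<U>) y" and "b = L (\<V> \<inter> \<U>) z" and "\<sigma> = L \<U> z"
      have zM: "z \<in> M" and dz: "d y z < \<delta>" using z by auto
      have ab: "\<bar>a - b\<bar> \<le> \<delta>" "\<bar>\<rho> - \<sigma>\<bar> \<le> \<delta>"
        using lip[OF yM zM, of "\<V> \<inter> \<U>"] lip[OF yM zM, of \<U>] dz
        by (simp_all add: a_def b_def \<sigma>_def \<rho>_def)
      have a: "0 \<le> a" "a \<le> \<rho>" using Lnn Lle by (simp_all add: a_def \<rho>_def)
      have \<sigma>: "\<rho> / 2 \<le> \<sigma>" "0 < \<sigma>" using ab(2) \<delta>(2) \<rho> by linarith+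
      have "a / \<rho> - b / \<sigma> = (a * (\<sigma> - \<rho>) + \<rho> * (a - b)) / (\<rho> * \<sigma>)"
        using \<rho> \<sigma> by (simp add: field_simps)
      also have "\<bar>\<dots>\<bar> \<le> (\<rho> * \<delta> + \<rho> * \<delta>) / (\<rho> * \<sigma>)"
      proof -
        have "\<bar>a * (\<sigma> - \<rho>)\<bar> \<le> \<rho> * \<delta>"
          unfolding abs_mult using a ab(2) \<rho> by (intro mult_mono) auto
        moreover have "\<bar>\<rho> * (a - b)\<bar> \<le> \<rho> * \<delta>"
          unfolding abs_mult using ab(1) \<rho> by (intro mult_mono) auto
        ultimately have num: "\<bar>a * (\<sigma> - \<rho>) + \<rho> * (a - b)\<bar> \<le> \<rho> * \<delta> + \<rho> * \<delta>" by linarith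
        have "0 \<le> \<rho> * \<sigma>" using \<rho> \<sigma> by simp
        then show ?thesis
          unfolding abs_divide abs_of_nonneg[OF \<open>0 \<le> \<rho> * \<sigma>\<close>] by (rule divide_right_mono[OF num])
      qed
      also have "\<dots> = 2 * \<delta> / \<sigma>" using \<rho> by simp
      also have "\<dots> \<le> e / 2"
      proof -
        have "e * \<rho> \<le> e * (2 * \<sigma>)" using \<sigma>(1) e by (intro mult_left_mono) auto
        then have "8 * \<delta> \<le> e * (2 * \<sigma>)" using \<delta>(3) by (rule order_trans[rotated])
        then show ?thesis using \<sigma>(2) by (simp add: field_simps)
      qed
      finally have "\<bar>a / \<rho> - b / \<sigma>\<bar> \<le> e / 2" .
      then show ?thesis unfolding h_def a_def[symmetric] b_def[symmetric] \<rho>_def[symmetric] \<sigma>_def[symmetric]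
        by linarith
    qed
    moreover have "openin Y (mball y \<delta>)" "y \<in> mball y \<delta>" using yM \<delta>(1) by (simp_all add: Y)
    ultimately show "\<exists>W. openin Y W \<and> y \<in> W \<and> (\<forall>z\<in>W. \<forall>\<V>. \<bar>h \<V> y - h \<V> z\<bar> \<le> e)" by blast
  qed
  then show ?thesis by blast
qed

definition additive_group :: "'b::ab_group_add monoid"
  where "additive_group = \<lparr>carrier = UNIV, mult = (+), one = 0\<rparr>"

lemma additive_group_simps [simp]:
  "carrier additive_group = UNIV" "x \<otimes>\<^bsub>additive_group\<^esub> y = x + y" "\<one>\<^bsub>additive_group\<^esub> = 0"
  by (simp_all add: additive_group_def)

lemma comm_group_additive_group: "comm_group (additive_group :: 'b::ab_group_add monoid)"
proof (rule comm_groupI)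
  show "\<exists>y\<in>carrier additive_group. y \<otimes>\<^bsub>additive_group\<^esub> x = \<one>\<^bsub>additive_group\<^esub>" for x :: 'b
    by (rule bexI[of _ "- x"]) simp_all
qed (simp_all add: ac_simps)

lemma inv_additive_group: "inv\<^bsub>additive_group\<^esub> x = - x"
  by (rule group.inv_equality[OF comm_group.axioms(2)[OF comm_group_additive_group]]) simp_all

lemma topological_group_additive_group:
  "topological_group (additive_group :: 'b::real_normed_vector monoid) euclidean"
proof (intro topological_group.intro topological_group_axioms.intro)
  show "group (additive_group :: 'b monoid)" using comm_group_additive_group by (rule comm_group.axioms(2))
  have "continuous_on UNIV (\<lambda>z :: 'b \<times> 'b. fst z + snd z)" by (intro continuous_intros)
  then show "continuous_map (prod_topology euclidean euclidean) euclidean (\<lambda>(x, y :: 'b). x \<otimes>\<^bsub>additive_group\<^esub> y)"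
    by (simp add: case_prod_unfold)
  have "continuous_on UNIV (\<lambda>x :: 'b. - x)" by (intro continuous_intros)
  then show "continuous_map euclidean euclidean (\<lambda>x :: 'b. inv\<^bsub>additive_group\<^esub> x)"
    by (simp add: inv_additive_group)
qed simp

text \<open>
  Points occur in a sum with positive sign and the test functions are nonnegative, so no
  cancellation can hide a point that is not covered.
\<close>

lemma free_abelian_o_bounded_imp_Scheepers:
  fixes X :: "'x topology" and A :: "('a, 'm) monoid_scheme" and Y :: "'y topology"
  assumes free: "free_abelian_topological_group X A T j" and oA: "o_bounded A T"
    and gen: "carrier A = generate A (j ` topspace X)"
    and "metrizable_space Y" and f: "continuous_map X Y f" "f ` topspace X = topspace Y"
  shows "Scheepers_space Y"
  unfolding Scheepers_space_def
proof (intro allI impI)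
  have "topological_group A T" and emb: "embedding_map X T j"
    using free unfolding free_abelian_topological_group_def by blast+
  interpret topological_group A T by fact
  have jA: "j ` topspace X \<subseteq> carrier A" by (rule embedding_map_into_carrier[OF \<open>topological_group A T\<close> emb])
  fix \<U> :: "nat \<Rightarrow> 'y set set"
  assume \<U>: "\<forall>n. open_cover Y (\<U> n)"
  have "\<forall>n. \<exists>h. cover_testing_family Y (\<U> n) h"
    using \<U> exists_cover_testing_family[OF assms(4)] by simp
  from choice[OF this] obtain h where "\<forall>n. cover_testing_family Y (\<U> n) (h n)" by (rule exE)
  note h = this[rule_format]
  have h01: "0 \<le> h n \<V> y" "h n \<V> y \<le> 1" for n \<V> y using h[of n] by (simp_all add: cover_testing_family_def)
  have vanish: "\<exists>U\<in>\<U> n. \<forall>\<V>. U \<in> \<V> \<longrightarrow> h n \<V> y = 0" if "y \<in> topspace Y" for n y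
    using h[of n] that by (simp add: cover_testing_family_def)
  have meets: "y \<in> \<Union>(\<V> \<inter> \<U> n)" if "y \<in> topspace Y" "h n \<V> y < 1" for n \<V> y
    using h[of n] that unfolding cover_testing_family_def by (elim conjE) (drule (1) bspec, blast)
  define \<phi> where "\<phi> n x = Bcontfun (\<lambda>\<V> :: 'y set set discrete. h n (of_discrete \<V>) (f x))" for n x
  have \<phi>: "apply_bcontfun (\<phi> n x) \<V> = h n (of_discrete \<V>) (f x)" for n x \<V>
  proof -
    have "(\<lambda>\<V> :: 'y set set discrete. h n (of_discrete \<V>) (f x)) \<in> bcontfun"
      using h01 by (intro bcontfun_normI[of _ 1]) (auto simp: continuous_on_open_vimage open_discrete)
    then show ?thesis by (simp add: \<phi>_def Bcontfun_inverse)
  qed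
  have \<phi>_cont: "continuous_map X euclidean (\<phi> n)" for n
    unfolding mtopology_is_euclidean[symmetric] Met_TC.continuous_map_to_metric
  proof (intro ballI allI impI)
    fix x and e :: real assume x: "x \<in> topspace X" and e: "0 < e"
    have fx: "f x \<in> topspace Y" using x f(2) by blast
    have "\<forall>y\<in>topspace Y. \<forall>e>0. \<exists>W. openin Y W \<and> y \<in> W \<and>
        (\<forall>z\<in>W. \<forall>\<V>. \<bar>h n \<V> y - h n \<V> z\<bar> \<le> e)"
      using h[of n] by (simp add: cover_testing_family_def)
    then obtain W where W: "openin Y W" "f x \<in> W" "\<forall>z\<in>W. \<forall>\<V>. \<bar>h n \<V> (f x) - h n \<V> z\<bar> \<le> e / 2"
      using fx e half_gt_zero by meson
    have "openin X {z \<in> topspace X. f z \<in> W}" using f(1) W(1) by (rule openin_continuous_map_preimage)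
    moreover have "\<phi> n z \<in> Met_TC.mball (\<phi> n x) e" if "z \<in> {z \<in> topspace X. f z \<in> W}" for z
    proof -
      have "dist (\<phi> n x) (\<phi> n z) \<le> e / 2"
        using that W(3) by (intro dist_bound) (simp add: \<phi> dist_real_def)
      then show ?thesis using e by simp
    qed
    ultimately show "\<exists>U. openin X U \<and> x \<in> U \<and> (\<forall>z\<in>U. \<phi> n z \<in> Met_TC.mball (\<phi> n x) e)"
      using x W(2) by (intro exI[of _ "{z \<in> topspace X. f z \<in> W}"]) simp
  qed
  have "\<exists>\<Phi>. extends_to_hom X A T j additive_group euclidean (\<phi> n) \<Phi>" for n
    using free_abelian_topological_group_universal[OF free topological_group_additive_group
        comm_group_additive_group \<phi>_cont[of n]] by blast
  then obtain \<Phi> where \<Phi>: "\<And>n. extends_to_hom X A T j additive_group euclidean (\<phi> n) (\<Phi> n)" by metis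
  have hom: "\<Phi> n \<in> hom A additive_group" and \<Phi>_cont: "continuous_map T euclidean (\<Phi> n)"
    and \<Phi>j: "\<And>x. x \<in> topspace X \<Longrightarrow> \<Phi> n (j x) = \<phi> n x" for n
    using \<Phi>[of n] by (simp_all add: extends_to_hom_def)
  have add: "\<Phi> n (a \<otimes>\<^bsub>A\<^esub> b) = \<Phi> n a + \<Phi> n b" if "a \<in> carrier A" "b \<in> carrier A" for n a b
    using hom_mult[OF hom that] by simp
  have gh: "group_hom A additive_group (\<Phi> n)" for n
    by (intro group_hom.intro group_hom_axioms.intro hom is_group
        comm_group.axioms(2)[OF comm_group_additive_group])
  have zero: "\<Phi> n \<one>\<^bsub>A\<^esub> = 0" for n using group_hom.hom_one[OF gh] by simp
  have neg: "\<Phi> n (inv\<^bsub>A\<^esub> a) = - \<Phi> n a" if "a \<in> carrier A" for n a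
    using group_hom.hom_inv[OF gh that] by (simp add: inv_additive_group)

  \<comment> \<open>An element of the free group involves finitely many points, so its coordinates vanish for all large subfamilies.\<close>
  have support: "\<exists>\<V>\<^sub>0. finite \<V>\<^sub>0 \<and> \<V>\<^sub>0 \<subseteq> \<U> n \<and> (\<forall>\<V>. \<V>\<^sub>0 \<subseteq> \<V> \<longrightarrow> apply_bcontfun (\<Phi> n a) (discrete \<V>) = 0)"
    if "a \<in> carrier A" for n a
    using that unfolding gen
  proof induction
    case one
    show ?case by (intro exI[of _ "{}"]) (simp add: zero)
  next
    case (incl a)
    then obtain x where x: "x \<in> topspace X" "a = j x" by blast
    then have "f x \<in> topspace Y" using f(2) by blast
    then obtain U where U: "U \<in> \<U> n" "\<forall>\<V>. U \<in> \<V> \<longrightarrow> h n \<V> (f x) = 0"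
      using vanish[of "f x" n] by blast
    then show ?case using x
      by (intro exI[of _ "{U}"]) (simp add: \<Phi>j \<phi> discrete_inverse)
  next
    case (inv a)
    then obtain x where x: "x \<in> topspace X" "a = j x" by blast
    then have "f x \<in> topspace Y" using f(2) by blast
    then obtain U where U: "U \<in> \<U> n" "\<forall>\<V>. U \<in> \<V> \<longrightarrow> h n \<V> (f x) = 0"
      using vanish[of "f x" n] by blast
    have "a \<in> carrier A" using inv jA by blast
    then show ?case using x U
      by (intro exI[of _ "{U}"]) (simp add: neg \<Phi>j \<phi> discrete_inverse)
  next
    case (eng a b)
    then have ab: "a \<in> carrier A" "b \<in> carrier A" by (simp_all add: gen)
    obtain \<V>a \<V>b where
      "finite \<V>a" "\<V>a \<subseteq> \<U> n" "\<forall>\<V>. \<V>a \<subseteq> \<V> \<longrightarrow> apply_bcontfun (\<Phi> n a) (discrete \<V>) = 0"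
      "finite \<V>b" "\<V>b \<subseteq> \<U> n" "\<forall>\<V>. \<V>b \<subseteq> \<V> \<longrightarrow> apply_bcontfun (\<Phi> n b) (discrete \<V>) = 0"
      using eng.IH by blast
    then show ?case by (intro exI[of _ "\<V>a \<union> \<V>b"]) (simp add: add[OF ab])
  qed

  define W where "W n = {a \<in> topspace T. \<Phi> n a \<in> ball 0 1}" for n
  have "neighborhood_of_one A T (W n)" for n
  proof -
    have "openin T (W n)" unfolding W_def
      using \<Phi>_cont by (rule openin_continuous_map_preimage) simp
    moreover have "\<one>\<^bsub>A\<^esub> \<in> W n" by (simp add: W_def zero topspace_eq_carrier)
    ultimately show ?thesis unfolding neighborhood_of_one_def using openin_subset by blast
  qed
  then have "\<forall>n. neighborhood_of_one A T (W n)" by blast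
  from oA[unfolded o_bounded_def, THEN spec[of _ W], THEN mp, OF this]
  obtain E :: "nat \<Rightarrow> 'a set" where E: "\<forall>n. finite (E n) \<and> E n \<subseteq> carrier A"
    "carrier A = (\<Union>n. W n <#>\<^bsub>A\<^esub> E n)" by (elim exE conjE)
  define \<V>\<^sub>0 where "\<V>\<^sub>0 n a = (SOME \<W>. finite \<W> \<and> \<W> \<subseteq> \<U> n \<and>
      (\<forall>\<V>. \<W> \<subseteq> \<V> \<longrightarrow> apply_bcontfun (\<Phi> n a) (discrete \<V>) = 0))" for n a
  have \<V>\<^sub>0: "finite (\<V>\<^sub>0 n a) \<and> \<V>\<^sub>0 n a \<subseteq> \<U> n \<and>
      (\<forall>\<V>. \<V>\<^sub>0 n a \<subseteq> \<V> \<longrightarrow> apply_bcontfun (\<Phi> n a) (discrete \<V>) = 0)"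
    if "a \<in> carrier A" for n a
    unfolding \<V>\<^sub>0_def by (rule someI_ex[OF support[OF that]])
  define \<V> where "\<V> n = (\<Union>a\<in>E n. \<V>\<^sub>0 n a)" for n
  have EA: "a \<in> carrier A" if "a \<in> E n" for a n using that E(1) by blast
  have \<V>_fin: "finite (\<V> n)" for n
    unfolding \<V>_def using E(1) \<V>\<^sub>0 EA by (intro finite_UN_I) simp_all
  have \<V>_sub: "\<V> n \<subseteq> \<U> n" for n
    unfolding \<V>_def using \<V>\<^sub>0 EA by (intro UN_least) simp

  have covered: "\<exists>n. K \<subseteq> \<Union>(\<V> n)" if K: "finite K" "K \<subseteq> topspace Y" for K
  proof -
    obtain L where L: "L \<subseteq> topspace X" "finite L" "K = f ` L"
      using finite_subset_image[OF K(1)] K(2) f(2) by metis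
    obtain xs where xs: "set xs = L" using finite_list[OF L(2)] by blast
    \<comment> \<open>The sum of the points of K, taken over preimages in X.\<close>
    define w where "w = foldr (\<otimes>\<^bsub>A\<^esub>) (map j xs) \<one>\<^bsub>A\<^esub>"
    have word: "foldr (\<otimes>\<^bsub>A\<^esub>) (map j xs) \<one>\<^bsub>A\<^esub> \<in> carrier A \<and>
        apply_bcontfun (\<Phi> n (foldr (\<otimes>\<^bsub>A\<^esub>) (map j xs) \<one>\<^bsub>A\<^esub>)) (discrete \<W>) = (\<Sum>x\<leftarrow>xs. h n \<W> (f x))"
      if "set xs \<subseteq> topspace X" for n \<W> xs
      using that
    proof (induction xs)
      case Nil
      show ?case by (simp add: zero)
    next
      case (Cons x xs)
      then have "j x \<in> carrier A" using jA by auto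
      then show ?case using Cons by (simp add: add \<Phi>j \<phi> discrete_inverse)
    qed
    have "w \<in> carrier A" using word[of xs] xs L(1) by (simp add: w_def)
    then obtain n a c where a: "a \<in> W n" "c \<in> E n" "w = a \<otimes>\<^bsub>A\<^esub> c"
      using E(2) unfolding set_mult_def by blast
    have ac: "a \<in> carrier A" "c \<in> carrier A" using a E(1) by (auto simp: W_def topspace_eq_carrier)
    have "\<V>\<^sub>0 n c \<subseteq> \<V> n" using a(2) by (auto simp: \<V>_def)
    then have "apply_bcontfun (\<Phi> n c) (discrete (\<V> n)) = 0" using \<V>\<^sub>0[OF ac(2)] by blast
    then have "(\<Sum>x\<leftarrow>xs. h n (\<V> n) (f x)) = apply_bcontfun (\<Phi> n a) (discrete (\<V> n))"
      using word[of xs n "\<V> n"] xs L(1) a(3) add[OF ac] by (simp add: w_def)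
    also have "\<dots> < 1"
    proof -
      have "norm (\<Phi> n a) < 1" using a(1) by (simp add: W_def)
      then show ?thesis using norm_bounded[of "\<Phi> n a" "discrete (\<V> n)"] by simp
    qed
    finally have less: "(\<Sum>x\<leftarrow>xs. h n (\<V> n) (f x)) < 1" .
    have "f x \<in> \<Union>(\<V> n)" if "x \<in> L" for x
    proof -
      have "h n (\<V> n) (f x) \<le> (\<Sum>x\<leftarrow>xs. h n (\<V> n) (f x))"
        using that xs h01 by (intro member_le_sum_list) auto
      then have "h n (\<V> n) (f x) < 1" using less by simp
      moreover have "f x \<in> topspace Y" using that L(1) f(2) by blast
      ultimately show ?thesis using meets[of "f x" n "\<V> n"] by blast
    qed
    then show ?thesis using L(3) by blast
  qed
  have "\<Union>(range (\<lambda>n. \<Union>(\<V> n))) = topspace Y"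
  proof
    have "\<Union>(\<V> n) \<subseteq> topspace Y" for n
      using \<V>_sub[of n] \<U> unfolding open_cover_def by blast
    then show "\<Union>(range (\<lambda>n. \<Union>(\<V> n))) \<subseteq> topspace Y" by blast
    show "topspace Y \<subseteq> \<Union>(range (\<lambda>n. \<Union>(\<V> n)))"
    proof
      fix y assume "y \<in> topspace Y"
      then obtain n where "{y} \<subseteq> \<Union>(\<V> n)" using covered[of "{y}"] by auto
      then show "y \<in> \<Union>(range (\<lambda>n. \<Union>(\<V> n)))" by blast
    qed
  qed
  then have "omega_cover (topspace Y) (range (\<lambda>n. \<Union>(\<V> n)))"
    using covered by (simp add: omega_cover_def)
  then show "\<exists>\<V>. (\<forall>n. finite (\<V> n) \<and> \<V> n \<subseteq> \<U> n) \<and> omega_cover (topspace Y) (range (\<lambda>n. \<Union>(\<V> n)))"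
    using \<V>_fin \<V>_sub by (intro exI[of _ \<V>]) simp
qed


section \<open>The characterization\<close>

theorem theorem1p2:
  fixes X :: "'x topology"
    and F :: "'f monoid" and TF :: "'f topology" and i :: "'x \<Rightarrow> 'f"
    and A :: "'a monoid" and TA :: "'a topology" and j :: "'x \<Rightarrow> 'a"
  assumes no_Q_point: "\<not> (\<exists>U. Q_point U)"
    and "tychonov_space X"
    and "free_topological_group X F TF i"
    and "free_abelian_topological_group X A TA j"
  shows "((\<forall>n. o_bounded (power_group n F) (power_topology n TF)) \<longleftrightarrow> o_bounded F TF) \<and>
    (o_bounded F TF \<longleftrightarrow> o_bounded A TA) \<and>
    (o_bounded A TA \<longleftrightarrow>
      (\<forall>Y :: 'x topology. continuous_metrizable_image X Y \<longrightarrow> Scheepers_space Y))"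
proof -
  note freeF = \<open>free_topological_group X F TF i\<close>
  note freeA = \<open>free_abelian_topological_group X A TA j\<close>
  have F: "topological_group F TF" and i: "embedding_map X TF i"
    using freeF unfolding free_topological_group_def by blast+
  have A: "topological_group A TA" and j: "embedding_map X TA j"
    using freeA unfolding free_abelian_topological_group_def by blast+
  have i_cont: "continuous_map X TF i" and j_cont: "continuous_map X TA j"
    using i j unfolding embedding_map_def
    by (meson homeomorphic_imp_continuous_map continuous_map_into_fulltopology)+
  note genF = free_topological_group_generated[OF freeF]
  note genA = free_abelian_topological_group_generated[OF freeA]
  let ?powers = "\<forall>n. o_bounded (power_group n F) (power_topology n TF)"
  let ?images = "\<forall>Y :: 'x topology. continuous_metrizable_image X Y \<longrightarrow> Scheepers_space Y"

  have "o_bounded F TF" if ?powers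
  proof (rule o_bounded_hom_image[OF _ F])
    show "topological_group (power_group 1 F) (power_topology 1 TF)"
      by (rule topological_group_product) (rule F)
    show "o_bounded (power_group 1 F) (power_topology 1 TF)" using that ..
    show "(\<lambda>z. z 0) \<in> hom (power_group 1 F) F" by (auto simp: hom_def)
    show "continuous_map (power_topology 1 TF) TF (\<lambda>z. z 0)"
      by (rule continuous_map_product_projection) simp
    show "(\<lambda>z. z 0) ` carrier (power_group 1 F) = carrier F"
    proof
      show "(\<lambda>z. z 0) ` carrier (power_group 1 F) \<subseteq> carrier F" by auto
      show "carrier F \<subseteq> (\<lambda>z. z 0) ` carrier (power_group 1 F)"
      proof
        fix y assume "y \<in> carrier F"
        then show "y \<in> (\<lambda>z. z 0) ` carrier (power_group 1 F)"
          by (intro image_eqI[of _ _ "\<lambda>k\<in>{..<1::nat}. y"]) auto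
      qed
    qed
  qed

  moreover have "o_bounded A TA" if oF: "o_bounded F TF"
  proof -
    obtain \<Phi> where \<Phi>: "extends_to_hom X F TF i A TA j \<Phi>"
      using free_topological_group_universal[OF freeF A j_cont] by blast
    have hom: "\<Phi> \<in> hom F A" and cont: "continuous_map TF TA \<Phi>"
      and eq: "\<And>x. x \<in> topspace X \<Longrightarrow> \<Phi> (i x) = j x"
      using \<Phi> by (simp_all add: extends_to_hom_def)
    have gh: "group_hom F A \<Phi>"
      by (intro group_hom.intro group_hom_axioms.intro hom
          topological_group.axioms(1)[OF F] topological_group.axioms(1)[OF A])
    have "\<Phi> ` i ` topspace X = j ` topspace X" unfolding image_image using eq by (rule image_cong[OF refl])
    then have "\<Phi> ` carrier F = carrier A"
      using group_hom.generate_img[OF gh embedding_map_into_carrier(2)[OF F i]]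
      by (simp only: genF[symmetric] genA[symmetric])
    then show ?thesis by (rule o_bounded_hom_image[OF F A oF hom cont])
  qed

  moreover have ?images if oA: "o_bounded A TA"
  proof (intro allI impI)
    fix Y :: "'x topology" assume "continuous_metrizable_image X Y"
    then obtain f where "metrizable_space Y" "continuous_map X Y f" "f ` topspace X = topspace Y"
      unfolding continuous_metrizable_image_def by blast
    then show "Scheepers_space Y" by (rule free_abelian_o_bounded_imp_Scheepers[OF freeA oA genA])
  qed

  moreover have ?powers if images: ?images
  proof
    fix n
    show "o_bounded (power_group n F) (power_topology n TF)"
      by (rule o_bounded_powers_of_Scheepers_generated[OF no_Q_point F i_cont genF])
        (use images in blast)
  qed

  ultimately show ?thesis by blast
qed

end
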